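(* Let $\mathbf U$ be the submodule of the $U_q(\widehat{\mathfrak{sl}}_2)$-module $\mathbb U$ generated by the vector $\mathbf 1$, and let $\mathbf V\subseteq\mathbb V$ be the intersection of the kernel of $B^*_L$ and the kernel of $(A^*_L)^2$. Then $\mathbf U=\mathbb U\cap\mathbf V$.
   Context: $\mathbb F$ is a field of characteristic zero and $q\in\mathbb F$ is nonzero and not a root of unity. All vector spaces and algebras are over $\mathbb F$; algebras are associative with unit. The $q$-shuffle algebra. $\mathbb V$ is the free algebra on noncommuting $x,y$ (called letters); words $\ell_1\ell_2\cdots\ell_n$ in the letters form a basis of $\mathbb V$, and $\mathbf 1$ denotes the empty word. Set $(x,x)=(y,y)=2$, $(x,y)=(y,x)=-2$. The $q$-shuffle product $\star$ is the associative bilinear product on $\mathbb V$ with $\mathbf 1\star v=v\star\mathbf 1=v$ for $v\in\mathbb V$, and for nonempty words $u=u_1\cdots u_r$, $v=v_1\cdots v_s$: $u\star v=u_1\bigl((u_2\cdots u_r)\star v\bigr)+v_1\bigl(u\star(v_2\cdots v_s)\bigr)q^{(u_1,v_1)+(u_2,v_1)+\cdots+(u_r,v_1)}$. $\mathbb U$ is the subalgebra of the $q$-shuffle algebra $(\mathbb V,\star)$ generated by $x,y$. Linear maps $\mathbb V\to\mathbb V$. $X$ is the automorphism of the free algebra $\mathbb V$ with $x\mapsto qx$, $y\mapsto y$; $K$ is the automorphism of the free algebra $\mathbb V$ with $x\mapsto q^2x$, $y\mapsto q^{-2}y$. The maps $A^*_L,B^*_L,A^*_R,B^*_R$ send $\mathbf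 1\mapsto0$ and, for a nonempty word $w=\ell_1\cdots\ell_n$, $A^*_Lw=\delta_{\ell_1,x}\,\ell_2\cdots\ell_n$, $B^*_Lw=\delta_{\ell_1,y}\,\ell_2\cdots\ell_n$, $A^*_Rw=\delta_{\ell_n,x}\,\ell_1\cdots\ell_{n-1}$, $B^*_Rw=\delta_{\ell_n,y}\,\ell_1\cdots\ell_{n-1}$, where $\delta$ is the Kronecker delta. For $v\in\mathbb V$: $A_\ell v=x\star v$, $B_\ell v=y\star v$, $A_rv=v\star x$, $B_rv=v\star y$. (Thus $\mathbf V$ is the span of the words that do not begin with $y$ or $xx$.) The algebra $U_q(\widehat{\mathfrak{sl}}_2)$. Write $[a,b]=ab-ba$ and $[a,b]_p=p\,ab-p^{-1}ba$. Let $\mathbf A=\begin{pmatrix}2&-2\\-2&2\end{pmatrix}$ with rows and columns indexed by $0,1$. $U_q(\widehat{\mathfrak{sl}}_2)$ is the algebra with generators $K_i^{\pm1},D^{\pm1},E_i,F_i$ ($i\in\{0,1\}$) and relations, for $i,j\in\{0,1\}$: $K_iK_i^{-1}=K_i^{-1}K_i=1$, $DD^{-1}=D^{-1}D=1$; $[K_i,K_j]=0$, $[D,K_i]=0$; $K_iE_jK_i^{-1}=q^{\mathbf A_{i,j}}E_j$, $K_iF_jK_i^{-1}=q^{-\mathbf A_{i,j}}F_j$; $DE_0D^{-1}=qE_0$, $DF_0D^{-1}=q^{-1}F_0$, $[D,E_1]=0$, $[D,F_1]=0$; $[E_i,F_j]=\delta_{i,j}\frac{K_i-K_i^{-1}}{q-q^{-1}}$;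 and for $i\ne j$, $[E_i,[E_i,[E_i,E_j]_q]_{q^{-1}}]=0$, $[F_i,[F_i,[F_i,F_j]_q]_{q^{-1}}]=0$. Module structure on $\mathbb U$. $\mathbb U$ is the $U_q(\widehat{\mathfrak{sl}}_2)$-module on which (restricting maps to $\mathbb U$) $E_0$ acts as $A^*_R$, $F_0$ as $\frac{qA_rK^{-1}-q^{-1}A_\ell}{q-q^{-1}}$, $K_0^{\pm1}$ as $q^{\pm1}K^{\mp1}$, $E_1$ as $B^*_R$, $F_1$ as $\frac{B_rK-B_\ell}{q-q^{-1}}$, $K_1^{\pm1}$ as $K^{\pm1}$, $D^{\pm1}$ as $X^{\mp1}$. *)

theory Defs
  imports
    Complex_Main
    "HOL-Library.Poly_Mapping"
    "HOL-Algebra.QuotRing"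
begin

section \<open>Free algebras\<close>

text \<open>
  Words over an alphabet \<open>'g\<close> are lists, made into a monoid under concatenation. Then
  \<open>'g list \<Rightarrow>\<^sub>0 'a\<close>, with the convolution product that \<^theory>\<open>HOL-Library.Poly_Mapping\<close>
  provides, is the free \<open>'a\<close>-algebra on \<open>'g\<close>; its unit is the empty word.
\<close>

instantiation list :: (type) monoid_add
begin

definition zero_list :: "'a list" where "zero_list = []"

definition plus_list :: "'a list \<Rightarrow> 'a list \<Rightarrow> 'a list" where "plus_list = (@)"

instance
  by standard (simp_all add: zero_list_def plus_list_def)

end

type_synonym ('g, 'a) free_alg = "'g list \<Rightarrow>\<^sub>0 'a"

definition scale :: "'a::field \<Rightarrow> ('g, 'a) free_alg \<Rightarrow> ('g, 'a) free_alg"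
  where "scale c v = Poly_Mapping.map ((*) c) v"

lemma lookup_scale [simp]: "Poly_Mapping.lookup (scale c v) w = c * Poly_Mapping.lookup v w"
  by (simp add: scale_def Poly_Mapping.map.rep_eq when_def)

global_interpretation free_alg: vector_space "scale :: 'a::field \<Rightarrow> ('g, 'a) free_alg \<Rightarrow> _"
  by standard (rule poly_mapping_eqI, simp add: lookup_add algebra_simps)+

definition word :: "'g list \<Rightarrow> ('g, 'a::field) free_alg"
  where "word w = Poly_Mapping.single w 1"

abbreviation gen :: "'g \<Rightarrow> ('g, 'a::field) free_alg"
  where "gen g \<equiv> word [g]"

text \<open>The linear map with prescribed values on the basis of words.\<close>

definition lin_ext ::
  "('g list \<Rightarrow> ('h, 'a) free_alg) \<Rightarrow> ('g, 'a::field) free_alg \<Rightarrow> ('h, 'a) free_alg"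
  where "lin_ext f v = (\<Sum>w\<in>Poly_Mapping.keys v. scale (Poly_Mapping.lookup v w) (f w))"

text \<open>The algebra homomorphism with prescribed values on the generators.\<close>

definition alg_hom ::
  "('g \<Rightarrow> ('h, 'a) free_alg) \<Rightarrow> ('g, 'a::field) free_alg \<Rightarrow> ('h, 'a) free_alg"
  where "alg_hom f = lin_ext (\<lambda>w. prod_list (map f w))"

section \<open>The \<open>q\<close>-shuffle algebra\<close>

datatype letter = Lx | Ly

type_synonym 'a VV = "(letter, 'a) free_alg"

definition form :: "letter \<Rightarrow> letter \<Rightarrow> int"
  where "form a b = (if a = b then 2 else -2)"

fun qshuffle_words :: "'a::field \<Rightarrow> letter list \<Rightarrow> letter list \<Rightarrow> 'a VV"
  where
    "qshuffle_words q [] v = word v"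
  | "qshuffle_words q u [] = word u"
  | "qshuffle_words q (a # u) (b # v) =
       gen a * qshuffle_words q u (b # v) +
       scale (q powi (\<Sum>c\<leftarrow>a # u. form c b)) (gen b * qshuffle_words q (a # u) v)"

definition qshuffle :: "'a::field \<Rightarrow> 'a VV \<Rightarrow> 'a VV \<Rightarrow> 'a VV"
  where "qshuffle q u v = lin_ext (\<lambda>u'. lin_ext (qshuffle_words q u') v) u"

definition qshuffle_subalgebra :: "'a::field \<Rightarrow> 'a VV set \<Rightarrow> bool"
  where "qshuffle_subalgebra q S \<longleftrightarrow>
    free_alg.subspace S \<and> word [] \<in> S \<and> (\<forall>u\<in>S. \<forall>v\<in>S. qshuffle q u v \<in> S)"

definition UU :: "'a::field \<Rightarrow> 'a VV set"
  where "UU q = qshuffle_subalgebra q hull {gen Lx, gen Ly}"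

section \<open>Linear maps on the \<open>q\<close>-shuffle algebra\<close>

definition X_map :: "'a::field \<Rightarrow> 'a VV \<Rightarrow> 'a VV"
  where "X_map q = alg_hom (\<lambda>a. case a of Lx \<Rightarrow> scale q (gen Lx) | Ly \<Rightarrow> gen Ly)"

definition K_map :: "'a::field \<Rightarrow> 'a VV \<Rightarrow> 'a VV"
  where "K_map q = alg_hom (\<lambda>a. case a of
    Lx \<Rightarrow> scale (q powi 2) (gen Lx) | Ly \<Rightarrow> scale (q powi (-2)) (gen Ly))"

text \<open>\<open>inv\<close> itself is group-inverse notation once \<^theory>\<open>HOL-Algebra.Group\<close> is loaded.\<close>

abbreviation X_inv :: "'a::field \<Rightarrow> 'a VV \<Rightarrow> 'a VV"
  where "X_inv q \<equiv> inv_into UNIV (X_map q)"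

abbreviation K_inv :: "'a::field \<Rightarrow> 'a VV \<Rightarrow> 'a VV"
  where "K_inv q \<equiv> inv_into UNIV (K_map q)"

definition strip_first :: "letter \<Rightarrow> 'a::field VV \<Rightarrow> 'a VV"
  where "strip_first a = lin_ext (\<lambda>w. if w \<noteq> [] \<and> hd w = a then word (tl w) else 0)"

definition strip_last :: "letter \<Rightarrow> 'a::field VV \<Rightarrow> 'a VV"
  where "strip_last a = lin_ext (\<lambda>w. if w \<noteq> [] \<and> last w = a then word (butlast w) else 0)"

abbreviation A_L_star :: "'a::field VV \<Rightarrow> 'a VV" where "A_L_star \<equiv> strip_first Lx"
abbreviation B_L_star :: "'a::field VV \<Rightarrow> 'a VV" where "B_L_star \<equiv> strip_first Ly"
abbreviation A_R_star :: "'a::field VV \<Rightarrow> 'a VV" where "A_R_star \<equiv> strip_last Lx"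
abbreviation B_R_star :: "'a::field VV \<Rightarrow> 'a VV" where "B_R_star \<equiv> strip_last Ly"

definition A_l :: "'a::field \<Rightarrow> 'a VV \<Rightarrow> 'a VV" where "A_l q v = qshuffle q (gen Lx) v"
definition B_l :: "'a::field \<Rightarrow> 'a VV \<Rightarrow> 'a VV" where "B_l q v = qshuffle q (gen Ly) v"
definition A_r :: "'a::field \<Rightarrow> 'a VV \<Rightarrow> 'a VV" where "A_r q v = qshuffle q v (gen Lx)"
definition B_r :: "'a::field \<Rightarrow> 'a VV \<Rightarrow> 'a VV" where "B_r q v = qshuffle q v (gen Ly)"

definition V_bold :: "'a::field VV set"
  where "V_bold = {v. B_L_star v = 0} \<inter> {v. (A_L_star ^^ 2) v = 0}"

section \<open>The algebra \<open>U\<^sub>q\<close> of affine type \<open>sl\<^sub>2\<close>\<close>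

datatype node = N0 | N1

datatype uq_gen =
  K_gen node | Kinv_gen node | D_gen | Dinv_gen | E_gen node | F_gen node

definition cartan :: "node \<Rightarrow> node \<Rightarrow> int"
  where "cartan i j = (if i = j then 2 else -2)"

definition comm :: "('g, 'a::field) free_alg \<Rightarrow> ('g, 'a) free_alg \<Rightarrow> ('g, 'a) free_alg"
  where "comm a b = a * b - b * a"

definition qcomm :: "'a::field \<Rightarrow> ('g, 'a) free_alg \<Rightarrow> ('g, 'a) free_alg \<Rightarrow> ('g, 'a) free_alg"
  where "qcomm p a b = scale p (a * b) - scale (inverse p) (b * a)"

text \<open>A defining relation \<open>a = b\<close> is represented by the element \<open>a - b\<close> of the free algebra.\<close>

inductive_set Uq_relators :: "'a::field \<Rightarrow> (uq_gen, 'a) free_alg set" for q :: 'a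
  where
    "gen (K_gen i) * gen (Kinv_gen i) - 1 \<in> Uq_relators q"
  | "gen (Kinv_gen i) * gen (K_gen i) - 1 \<in> Uq_relators q"
  | "gen D_gen * gen Dinv_gen - 1 \<in> Uq_relators q"
  | "gen Dinv_gen * gen D_gen - 1 \<in> Uq_relators q"
  | "comm (gen (K_gen i)) (gen (K_gen j)) \<in> Uq_relators q"
  | "comm (gen D_gen) (gen (K_gen i)) \<in> Uq_relators q"
  | "gen (K_gen i) * gen (E_gen j) * gen (Kinv_gen i)
       - scale (q powi cartan i j) (gen (E_gen j)) \<in> Uq_relators q"
  | "gen (K_gen i) * gen (F_gen j) * gen (Kinv_gen i)
       - scale (q powi (- cartan i j)) (gen (F_gen j)) \<in> Uq_relators q"
  | "gen D_gen * gen (E_gen N0) * gen Dinv_gen - scale q (gen (E_gen N0)) \<in> Uq_relators q"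
  | "gen D_gen * gen (F_gen N0) * gen Dinv_gen
       - scale (inverse q) (gen (F_gen N0)) \<in> Uq_relators q"
  | "comm (gen D_gen) (gen (E_gen N1)) \<in> Uq_relators q"
  | "comm (gen D_gen) (gen (F_gen N1)) \<in> Uq_relators q"
  | "comm (gen (E_gen i)) (gen (F_gen j))
       - (if i = j then scale (inverse (q - inverse q)) (gen (K_gen i) - gen (Kinv_gen i)) else 0)
       \<in> Uq_relators q"
  | "i \<noteq> j \<Longrightarrow> comm (gen (E_gen i))
       (qcomm (inverse q) (gen (E_gen i)) (qcomm q (gen (E_gen i)) (gen (E_gen j))))
       \<in> Uq_relators q"
  | "i \<noteq> j \<Longrightarrow> comm (gen (F_gen i))
       (qcomm (inverse q) (gen (F_gen i)) (qcomm q (gen (F_gen i)) (gen (F_gen j))))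
       \<in> Uq_relators q"

definition free_ring :: "('g, 'a::field) free_alg ring"
  where "free_ring =
    \<lparr>carrier = UNIV, monoid.mult = (*), one = 1, ring.zero = 0, ring.add = (+)\<rparr>"

definition Uq_ideal :: "'a::field \<Rightarrow> (uq_gen, 'a) free_alg set"
  where "Uq_ideal q = genideal free_ring (Uq_relators q)"

definition Uq :: "'a::field \<Rightarrow> (uq_gen, 'a) free_alg set ring"
  where "Uq q = free_ring Quot Uq_ideal q"

definition Uq_class :: "'a::field \<Rightarrow> (uq_gen, 'a) free_alg \<Rightarrow> (uq_gen, 'a) free_alg set"
  where "Uq_class q p = a_r_coset free_ring (Uq_ideal q) p"

section \<open>Modules\<close>

text \<open>
  \<open>act\<close> makes the subspace \<open>W\<close> of the free algebra on the two letters into a (unital) module over the algebra \<open>Uq q\<close>. The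
  scalar multiplication of \<open>Uq q\<close> is the one induced from the free algebra, and the last clause
  is its compatibility with that of \<open>W\<close>. Nothing is required of \<open>act\<close> outside \<open>W\<close>.
\<close>

definition Uq_module ::
  "'a::field \<Rightarrow> ((uq_gen, 'a) free_alg set \<Rightarrow> 'a VV \<Rightarrow> 'a VV) \<Rightarrow> 'a VV set \<Rightarrow> bool"
  where "Uq_module q act W \<longleftrightarrow>
    free_alg.subspace W \<and>
    (\<forall>a\<in>carrier (Uq q). \<forall>v\<in>W. act a v \<in> W) \<and>
    (\<forall>a\<in>carrier (Uq q). \<forall>v\<in>W. \<forall>w\<in>W. act a (v + w) = act a v + act a w) \<and>
    (\<forall>a\<in>carrier (Uq q). \<forall>c. \<forall>v\<in>W. act a (scale c v) = scale c (act a v)) \<and>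
    (\<forall>v\<in>W. act \<one>\<^bsub>Uq q\<^esub> v = v) \<and>
    (\<forall>a\<in>carrier (Uq q). \<forall>b\<in>carrier (Uq q). \<forall>v\<in>W.
       act (a \<otimes>\<^bsub>Uq q\<^esub> b) v = act a (act b v)) \<and>
    (\<forall>a\<in>carrier (Uq q). \<forall>b\<in>carrier (Uq q). \<forall>v\<in>W.
       act (a \<oplus>\<^bsub>Uq q\<^esub> b) v = act a v + act b v) \<and>
    (\<forall>c p. \<forall>v\<in>W. act (Uq_class q (scale c p)) v = scale c (act (Uq_class q p) v))"

definition Uq_submodule ::
  "'a::field \<Rightarrow> ((uq_gen, 'a) free_alg set \<Rightarrow> 'a VV \<Rightarrow> 'a VV) \<Rightarrow> 'a VV set \<Rightarrow> 'a VV set \<Rightarrow> bool"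
  where "Uq_submodule q act W N \<longleftrightarrow>
    N \<subseteq> W \<and> free_alg.subspace N \<and> (\<forall>a\<in>carrier (Uq q). \<forall>v\<in>N. act a v \<in> N)"

fun gen_map :: "'a::field \<Rightarrow> uq_gen \<Rightarrow> 'a VV \<Rightarrow> 'a VV"
  where
    "gen_map q (E_gen N0) v = A_R_star v"
  | "gen_map q (F_gen N0) v = scale (inverse (q - inverse q))
       (scale q (A_r q (K_inv q v)) - scale (inverse q) (A_l q v))"
  | "gen_map q (K_gen N0) v = scale q (K_inv q v)"
  | "gen_map q (Kinv_gen N0) v = scale (inverse q) (K_map q v)"
  | "gen_map q (E_gen N1) v = B_R_star v"
  | "gen_map q (F_gen N1) v = scale (inverse (q - inverse q)) (B_r q (K_map q v) - B_l q v)"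
  | "gen_map q (K_gen N1) v = K_map q v"
  | "gen_map q (Kinv_gen N1) v = K_inv q v"
  | "gen_map q D_gen v = X_inv q v"
  | "gen_map q Dinv_gen v = X_map q v"

text \<open>The prescribed action of the generators determines \<open>act\<close> on \<open>UU q\<close>.\<close>

definition UU_action ::
  "'a::field \<Rightarrow> ((uq_gen, 'a) free_alg set \<Rightarrow> 'a VV \<Rightarrow> 'a VV) \<Rightarrow> bool"
  where "UU_action q act \<longleftrightarrow>
    Uq_module q act (UU q) \<and> (\<forall>g. \<forall>v\<in>UU q. act (Uq_class q (gen g)) v = gen_map q g v)"

end

theory Submission
  imports Defs
begin

text \<open>
  The subspace \<open>N = UU q \<inter> V_bold\<close> is stable under the generators, so it contains the submodule
  \<open>U\<close> generated by \<open>1\<close>. For the converse, let \<open>v \<in> N\<close> be homogeneous with \<open>r\<close> letters \<open>x\<close> and \<open>s\<close>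
  letters \<open>y\<close>. By induction on \<open>r + s\<close>, both \<open>E\<^sub>0 v\<close> and \<open>E\<^sub>1 v\<close> lie in \<open>U\<close>.

  If \<open>r \<noteq> s\<close>, then for one of the two nodes \<open>v\<close> has negative weight. The maps \<open>A\<^sub>L\<^sup>*\<close> and
  \<open>B\<^sub>L\<^sup>*\<close> satisfy the \<open>q\<close>-Serre relations on \<open>UU q\<close>, which bounds the degrees in which \<open>N\<close> is
  nonzero, so \<open>F\<^sub>i\<close> is locally nilpotent on \<open>N\<close>, and the representation theory of \<open>sl\<^sub>2\<close> gives
  \<open>v \<in> U\<close>.

  If \<open>r = s > 0\<close>, a Casimir operator is used. Since \<open>UU q\<close> is a dual Verma module, the operator is a
  scalar on it, and for \<open>v\<close> this reads: \<open>(q powi (-6 * r) - 1) \<cdot> v\<close> is a sum of terms \<open>\<Phi>(v'') v'\<close>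
  over the splittings of \<open>v\<close> into \<open>v' v''\<close> with \<open>v'' \<noteq> 1\<close>. Here \<open>\<Phi>(z)\<close> is a polynomial in the
  \<open>F\<^sub>i\<close> for \<open>z \<in> UU q\<close>, and \<open>v' \<in> U\<close> because it arises from \<open>v\<close> by applying some of the \<open>E\<^sub>i\<close>.
\<close>

section \<open>Linear maps on free algebras\<close>

abbreviation lin :: "(('g, 'a::field) free_alg \<Rightarrow> ('h, 'a) free_alg) \<Rightarrow> bool"
  where "lin \<equiv> Vector_Spaces.linear scale scale"

lemma linI:
  assumes "\<And>u v. f (u + v) = f u + f v" "\<And>c v. f (scale c v) = scale c (f v)"
  shows "lin f"
  using assms by (simp add: Vector_Spaces.linear_iff free_alg.vector_space_axioms)

lemma lin_add: "lin f \<Longrightarrow> f (u + v) = f u + f v"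
  by (simp add: Vector_Spaces.linear_iff)

lemma lin_scale: "lin f \<Longrightarrow> f (scale c v) = scale c (f v)"
  by (simp add: Vector_Spaces.linear_iff)

lemma lin_0: "lin f \<Longrightarrow> f 0 = 0"
  using lin_add[of f 0 0] by simp

lemma lin_uminus: "lin f \<Longrightarrow> f (- v) = - f v"
  using lin_add[of f v "- v"] by (simp add: lin_0 eq_neg_iff_add_eq_0 add.commute)

lemma lin_diff: "lin f \<Longrightarrow> f (u - v) = f u - f v"
  using lin_add[of f u "- v"] by (simp add: lin_uminus)

lemma lin_sum: "lin f \<Longrightarrow> f (\<Sum>i\<in>I. v i) = (\<Sum>i\<in>I. f (v i))"
  by (induction I rule: infinite_finite_induct) (auto simp: lin_0 lin_add)

lemma lin_ident: "lin (\<lambda>v. v)" and lin_zero: "lin (\<lambda>v. 0)"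
  by (auto intro!: linI)

lemma lin_comp: "lin f \<Longrightarrow> lin g \<Longrightarrow> lin (\<lambda>v. f (g v))"
  by (auto intro!: linI simp: lin_add lin_scale)

lemma lin_plus: "lin f \<Longrightarrow> lin g \<Longrightarrow> lin (\<lambda>v. f v + g v)"
  by (auto intro!: linI simp: lin_add lin_scale algebra_simps free_alg.scale_right_distrib)

lemma lin_minus: "lin f \<Longrightarrow> lin g \<Longrightarrow> lin (\<lambda>v. f v - g v)"
  by (auto intro!: linI simp: lin_add lin_scale algebra_simps free_alg.scale_right_diff_distrib)

lemma lin_smult: "lin f \<Longrightarrow> lin (\<lambda>v. scale c (f v))"
  by (auto intro!: linI simp: lin_add lin_scale free_alg.scale_right_distrib mult.commute)

lemma lin_if: "lin f \<Longrightarrow> lin g \<Longrightarrow> lin (\<lambda>v. if b then f v else g v)"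
  by (cases b) simp_all

lemma lookup_word: "Poly_Mapping.lookup (word w) w' = (1 when w = w')"
  by (simp add: word_def lookup_single)

lemma keys_word [simp]: "Poly_Mapping.keys (word w :: ('g, 'a::field) free_alg) = {w}"
  by (simp add: word_def)

lemma lin_ext_supset:
  assumes "finite S" "Poly_Mapping.keys v \<subseteq> S"
  shows "lin_ext f v = (\<Sum>w\<in>S. scale (Poly_Mapping.lookup v w) (f w))"
  unfolding lin_ext_def using assms
  by (intro sum.mono_neutral_left) (auto simp: in_keys_iff)

lemma lin_lin_ext [simp]:
  fixes f :: "'g list \<Rightarrow> ('h, 'a::field) free_alg"
  shows "lin (lin_ext f)"
proof (rule linI)
  fix u v :: "('g, 'a) free_alg"
  let ?S = "Poly_Mapping.keys u \<union> Poly_Mapping.keys v"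
  have "Poly_Mapping.keys (u + v) \<subseteq> ?S"
    by (rule Poly_Mapping.keys_add)
  then show "lin_ext f (u + v) = lin_ext f u + lin_ext f v"
    by (simp add: lin_ext_supset[of ?S] lookup_add free_alg.scale_left_distrib sum.distrib)
next
  fix c and v :: "('g, 'a) free_alg"
  have "Poly_Mapping.keys (scale c v) \<subseteq> Poly_Mapping.keys v"
    by (auto simp: in_keys_iff)
  then show "lin_ext f (scale c v) = scale c (lin_ext f v)"
    by (simp add: lin_ext_supset[of "Poly_Mapping.keys v"] free_alg.scale_sum_right)
qed

lemma lin_ext_word [simp]: "lin_ext f (word w) = f w"
  by (simp add: lin_ext_def lookup_word)

lemma lookup_sum: "Poly_Mapping.lookup (\<Sum>i\<in>I. f i) w = (\<Sum>i\<in>I. Poly_Mapping.lookup (f i) w)"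
  by (induction I rule: infinite_finite_induct) (auto simp: lookup_add)

lemma lookup_lin_ext:
  "Poly_Mapping.lookup (lin_ext f v) w =
    (\<Sum>u\<in>Poly_Mapping.keys v. Poly_Mapping.lookup v u * Poly_Mapping.lookup (f u) w)"
  by (simp add: lin_ext_def lookup_sum)

lemma sum_keys_when:
  fixes v :: "('g, 'a::field) free_alg"
  shows "(\<Sum>u\<in>Poly_Mapping.keys v. Poly_Mapping.lookup v u * (c u when u = w)) =
    Poly_Mapping.lookup v w * c w"
proof -
  have "(\<Sum>u\<in>Poly_Mapping.keys v. Poly_Mapping.lookup v u * (c u when u = w)) =
    (\<Sum>u\<in>Poly_Mapping.keys v. if u = w then Poly_Mapping.lookup v w * c w else 0)"
    by (intro sum.cong) (auto simp: when_def)
  then show ?thesis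
    by (simp add: in_keys_iff)
qed

lemma lin_ext_words [simp]: "lin_ext word v = v"
  by (rule poly_mapping_eqI) (simp add: lookup_lin_ext lookup_word sum_keys_when)

lemma lin_eq_lin_ext: "lin f \<Longrightarrow> f v = lin_ext (\<lambda>w. f (word w)) v"
  by (subst lin_ext_words[of v, symmetric]) (simp add: lin_ext_def lin_sum lin_scale)

lemma lin_eqI:
  assumes "lin f" "lin g" "\<And>w. f (word w) = g (word w)"
  shows "f v = g v"
  by (subst (1 2) lin_eq_lin_ext) (simp_all add: assms)

lemma lin_ext_cong:
  "(\<And>w. w \<in> Poly_Mapping.keys v \<Longrightarrow> f w = g w) \<Longrightarrow> lin_ext f v = lin_ext g v"
  by (simp add: lin_ext_def)

lemma lin_lin_ext_fun:
  assumes "\<And>w. lin (\<lambda>v. f v w)"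
  shows "lin (\<lambda>v. lin_ext (f v) u)"
  using lin_add[OF assms] lin_scale[OF assms]
  by (intro linI) (simp_all add: lin_ext_def free_alg.scale_right_distrib sum.distrib
      free_alg.scale_sum_right mult.commute)

lemma lin_ext_in_subspace:
  "free_alg.subspace S \<Longrightarrow> (\<And>w. w \<in> Poly_Mapping.keys v \<Longrightarrow> f w \<in> S) \<Longrightarrow> lin_ext f v \<in> S"
  unfolding lin_ext_def by (intro free_alg.subspace_sum free_alg.subspace_scale)

section \<open>Words and the concatenation product\<close>

lemma scale_conv_mult: "scale c v = Poly_Mapping.single [] c * v"
  by (simp add: scale_def mult_map_scale_conv_mult zero_list_def)

lemma word_mult [simp]: "word u * word v = (word (u @ v) :: ('g, 'a::field) free_alg)"
  by (simp add: word_def mult_single plus_list_def)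

lemma word_Nil: "word [] = (1 :: ('g, 'a::field) free_alg)"
  by (simp add: word_def zero_list_def[symmetric])

lemma mult_scale_left: "scale c u * v = scale c (u * v :: ('g, 'a::field) free_alg)"
  by (simp add: scale_conv_mult mult.assoc)

lemma mult_scale_right: "u * scale c v = scale c (u * v :: ('g, 'a::field) free_alg)"
proof -
  have *: "lin (\<lambda>u. u * scale c v)" "lin (\<lambda>u. scale c (u * v))"
    by (auto intro!: linI simp: distrib_right mult_scale_left mult.commute
        free_alg.scale_right_distrib)
  have comm: "word w * Poly_Mapping.single [] c = Poly_Mapping.single [] c * word w" for w :: "'g list"
    by (simp add: word_def mult_single plus_list_def)
  show ?thesis
    by (rule lin_eqI[OF *]) (metis scale_conv_mult comm mult.assoc)
qed

lemma lin_mult_left: "lin (\<lambda>v. u * v)" and lin_mult_right: "lin (\<lambda>v. v * u)"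
  by (auto intro!: linI simp: distrib_right distrib_left mult_scale_left mult_scale_right)

lemmas lin_intros = lin_ident lin_zero lin_if lin_plus lin_minus lin_smult
  lin_comp[OF lin_lin_ext] lin_comp[OF lin_mult_left] lin_comp[OF lin_mult_right]

lemma lookup_gen_mult:
  "Poly_Mapping.lookup (gen a * v) w =
    (if w \<noteq> [] \<and> hd w = a then Poly_Mapping.lookup v (tl w) else 0)"
proof -
  have "gen a * v = lin_ext (\<lambda>u. word (a # u)) v"
    by (subst lin_eq_lin_ext[of "\<lambda>v. gen a * v"]) (simp_all add: lin_mult_left)
  then show ?thesis
    using sum_keys_when[of v "\<lambda>_. 1" "tl w"]
    by (cases w) (auto simp: lookup_lin_ext lookup_word)
qed

lemma lookup_mult_gen:
  "Poly_Mapping.lookup (v * gen a) w =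
    (if w \<noteq> [] \<and> last w = a then Poly_Mapping.lookup v (butlast w) else 0)"
proof -
  have "v * gen a = lin_ext (\<lambda>u. word (u @ [a])) v"
    by (subst lin_eq_lin_ext[of "\<lambda>v. v * gen a"]) (simp_all add: lin_mult_right)
  then show ?thesis
    using sum_keys_when[of v "\<lambda>_. 1" "butlast w"]
    by (cases w rule: rev_cases) (auto simp: lookup_lin_ext lookup_word)
qed

lemma lookup_strip_first:
  fixes v :: "'a::field VV"
  shows "Poly_Mapping.lookup (strip_first a v) w = Poly_Mapping.lookup v (a # w)"
proof -
  have "Poly_Mapping.lookup (if u \<noteq> [] \<and> hd u = a then word (tl u) else 0 :: 'a VV) w = (1 when u = a # w)" for u
    by (cases u) (auto simp: lookup_word when_def)
  then show ?thesis
    by (simp add: strip_first_def lookup_lin_ext sum_keys_when)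
qed

lemma lookup_strip_last:
  fixes v :: "'a::field VV"
  shows "Poly_Mapping.lookup (strip_last a v) w = Poly_Mapping.lookup v (w @ [a])"
proof -
  have "Poly_Mapping.lookup (if u \<noteq> [] \<and> last u = a then word (butlast u) else 0 :: 'a VV) w = (1 when u = w @ [a])" for u
    by (cases u rule: rev_cases) (auto simp: lookup_word when_def)
  then show ?thesis
    by (simp add: strip_last_def lookup_lin_ext sum_keys_when)
qed

lemma lin_strip_first: "lin (strip_first a)" and lin_strip_last: "lin (strip_last a)"
  by (simp_all add: strip_first_def strip_last_def)

lemma strip_first_word:
  "strip_first a (word w) = (if w \<noteq> [] \<and> hd w = a then word (tl w) else 0)"
  by (simp add: strip_first_def)

lemma strip_last_word:
  "strip_last a (word w) = (if w \<noteq> [] \<and> last w = a then word (butlast w) else 0)"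
  by (simp add: strip_last_def)

lemma strip_first_gen_mult: "strip_first a (gen b * v) = (if a = b then v else 0)"
  by (rule poly_mapping_eqI) (simp add: lookup_strip_first lookup_gen_mult)

lemma strip_last_mult_gen: "strip_last a (v * gen b) = (if a = b then v else 0)"
  by (rule poly_mapping_eqI) (simp add: lookup_strip_last lookup_mult_gen)

lemma strip_eqI:
  assumes "Poly_Mapping.lookup u [] = Poly_Mapping.lookup v []"
    and "\<And>a. strip_first a u = strip_first a v"
  shows "u = v"
proof (rule poly_mapping_eqI)
  fix w
  show "Poly_Mapping.lookup u w = Poly_Mapping.lookup v w"
    by (cases w) (use assms in \<open>auto simp flip: lookup_strip_first\<close>)
qed

section \<open>Diagonal maps in the word basis\<close>

definition diag :: "('g list \<Rightarrow> 'a::field) \<Rightarrow> ('g, 'a) free_alg \<Rightarrow> ('g, 'a) free_alg"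
  where "diag f = lin_ext (\<lambda>w. scale (f w) (word w))"

lemma lin_diag: "lin (diag f)"
  by (simp add: diag_def)

lemma diag_word [simp]: "diag f (word w) = scale (f w) (word w)"
  by (simp add: diag_def)

lemma lookup_diag [simp]: "Poly_Mapping.lookup (diag f v) w = f w * Poly_Mapping.lookup v w"
  using sum_keys_when[of v f w]
  by (simp add: diag_def lookup_lin_ext lookup_word when_def if_distrib[of "\<lambda>x. _ * x"] cong: if_cong)

lemma diag_diag: "diag f (diag g v) = diag (\<lambda>w. f w * g w) v"
  by (rule poly_mapping_eqI) simp

lemma diag_one: "diag (\<lambda>w. 1) v = v"
  by (rule poly_mapping_eqI) simp

lemma strip_first_diag: "strip_first a (diag f v) = diag (\<lambda>w. f (a # w)) (strip_first a v)"
  by (rule poly_mapping_eqI) (simp add: lookup_strip_first)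

lemma strip_last_diag: "strip_last a (diag f v) = diag (\<lambda>w. f (w @ [a])) (strip_last a v)"
  by (rule poly_mapping_eqI) (simp add: lookup_strip_last)

lemma diag_scale_fun: "diag (\<lambda>w. c * f w) v = scale c (diag f v)"
  by (rule poly_mapping_eqI) simp

section \<open>The \<open>q\<close>-shuffle product\<close>

lemma bilin_eqI:
  assumes "\<And>v. lin (\<lambda>u. f u v)" "\<And>u. lin (\<lambda>v. f u v)"
    and "\<And>v. lin (\<lambda>u. g u v)" "\<And>u. lin (\<lambda>v. g u v)"
    and "\<And>u v. f (word u) (word v) = g (word u) (word v)"
  shows "f u v = g u v"
  by (rule lin_eqI[OF assms(1,3)], rule lin_eqI[OF assms(2,4)], rule assms(5))

text \<open>The form has rank one: \<open>form a b = 2 * sg a * sg b\<close>. Hence the exponent in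
  the recursion for the product depends on the left word only through \<open>bal\<close>, the number
  of x minus the number of y.\<close>

fun sg :: "letter \<Rightarrow> int"
  where "sg Lx = 1" | "sg Ly = -1"

definition bal :: "letter list \<Rightarrow> int"
  where "bal w = (\<Sum>a\<leftarrow>w. sg a)"

lemma bal_simps [simp]:
  "bal [] = 0" "bal (a # w) = sg a + bal w" "bal (u @ w) = bal u + bal w" "bal (rev w) = bal w"
  by (simp_all add: bal_def rev_map[symmetric])

lemma sg_mult_self [simp]: "sg a * sg a = 1"
  by (cases a) simp_all

lemma form_sg: "form a b = 2 * sg a * sg b"
  by (cases a; cases b) (simp_all add: form_def)

lemma sum_form: "(\<Sum>c\<leftarrow>w. form c b) = 2 * bal w * sg b"
  by (induction w) (simp_all add: form_sg algebra_simps)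

locale quantum =
  fixes q :: "'a::field"
  assumes q_nonzero [simp]: "q \<noteq> 0"
begin

definition star :: "'a VV \<Rightarrow> 'a VV \<Rightarrow> 'a VV" (infixl "\<star>" 70)
  where "u \<star> v = qshuffle q u v"

text \<open>Multiplies a word \<open>w\<close> by \<open>q\<close> to the power \<open>(w, a)\<close>.\<close>

definition twist :: "letter \<Rightarrow> 'a VV \<Rightarrow> 'a VV"
  where "twist a = diag (\<lambda>w. q powi (2 * bal w * sg a))"

lemma q_powi_add: "q powi (m + n) = q powi m * q powi n"
  by (simp add: power_int_add)

lemma star_word: "word u \<star> word v = qshuffle_words q u v"
  by (simp add: star_def qshuffle_def)

lemma lin_star_left: "lin (\<lambda>u. u \<star> v)"
  by (simp add: star_def qshuffle_def)

lemma lin_star_right: "lin (\<lambda>v. u \<star> v)"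
  unfolding star_def qshuffle_def by (intro lin_lin_ext_fun) simp

lemma lin_twist: "lin (twist a)"
  by (simp add: twist_def lin_diag)

lemmas star_simps [simp] =
  lin_add[OF lin_star_left] lin_add[OF lin_star_right]
  lin_scale[OF lin_star_left] lin_scale[OF lin_star_right]
  lin_0[OF lin_star_left] lin_0[OF lin_star_right]
  lin_diff[OF lin_star_left] lin_diff[OF lin_star_right]

lemmas lin_rules = lin_intros
  lin_comp[OF lin_star_left] lin_comp[OF lin_star_right] lin_comp[OF lin_twist]
  lin_comp[OF lin_diag] lin_comp[OF lin_strip_first] lin_comp[OF lin_strip_last]

lemma star_Nil_left [simp]: "word [] \<star> v = v"
  by (rule lin_eqI) (intro lin_rules, intro lin_rules, simp add: star_word)

lemma star_Nil_right [simp]: "v \<star> word [] = v"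
proof (rule lin_eqI)
  show "word w \<star> word [] = word w" for w
    by (cases w) (simp_all add: star_word)
qed (intro lin_rules)+

lemma star_Cons:
  "word (a # u) \<star> word (b # v) = gen a * (word u \<star> word (b # v)) +
    scale (q powi (2 * bal (a # u) * sg b)) (gen b * (word (a # u) \<star> word v))"
  unfolding star_word qshuffle_words.simps sum_form by simp

text \<open>The recursion for the product says that removing the first letter is a skew derivation.
  This form is bilinear and needs no separate case for empty words.\<close>

lemma strip_first_star:
  "strip_first a (u \<star> v) = strip_first a u \<star> v + twist a u \<star> strip_first a v"
proof (rule bilin_eqI[where f = "\<lambda>u v. strip_first a (u \<star> v)"])
  fix u v :: "letter list"
  show "strip_first a (word u \<star> word v) =
      strip_first a (word u) \<star> word v + twist a (word u) \<star> strip_first a (word v)"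
    by (cases u; cases v) (auto simp: star_Cons lin_add[OF lin_strip_first]
        lin_scale[OF lin_strip_first] strip_first_gen_mult strip_first_word twist_def)
qed (intro lin_rules)+

definition counit :: "'a VV \<Rightarrow> 'a VV"
  where "counit v = diag (\<lambda>w. if w = [] then 1 else 0) v"

lemma lin_counit: "lin counit"
  unfolding counit_def by (intro lin_rules)

lemma counit_word: "counit (word w) = (if w = [] then word [] else 0)"
  by (simp add: counit_def)

lemma counit_star: "counit (u \<star> v) = counit u \<star> counit v"
proof (rule bilin_eqI[where f = "\<lambda>u v. counit (u \<star> v)"])
  have [simp]: "counit (gen a * v) = 0" for a v
    unfolding counit_def by (rule poly_mapping_eqI) (simp add: lookup_gen_mult)
  show "counit (word u \<star> word v) = counit (word u) \<star> counit (word v)" for u v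
    by (cases u; cases v)
      (auto simp: star_Cons counit_word lin_add[OF lin_counit] lin_scale[OF lin_counit])
qed (intro lin_rules lin_comp[OF lin_counit])+

text \<open>Both \<open>counit\<close> and \<open>strip_first\<close> obey a product rule, so this
  criterion reduces identities between products to shorter words.\<close>

lemma counit_strip_eqI:
  assumes "counit u = counit v" "\<And>a. strip_first a u = strip_first a v"
  shows "u = v"
proof (rule strip_eqI)
  have "Poly_Mapping.lookup (counit u) [] = Poly_Mapping.lookup (counit v) []"
    by (simp only: assms)
  then show "Poly_Mapping.lookup u [] = Poly_Mapping.lookup v []"
    by (simp add: counit_def)
qed (rule assms)

text \<open>A multiplicative \<open>f\<close> depends only on how often each letter occurs, and the
  shuffles of u and v only rearrange the letters of \<open>u @ v\<close>.\<close>

lemma diag_star: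
  assumes f_Nil: "f [] = 1" and f_append: "\<And>u v. f (u @ v) = f u * f v"
  shows "diag f (u \<star> v) = diag f u \<star> diag f v"
proof (rule bilin_eqI[where f = "\<lambda>u v. diag f (u \<star> v)"])
  have f_Cons: "f (a # w) = f [a] * f w" for a w
    using f_append[of "[a]" w] by simp
  have gen_mult: "diag f (gen a * v) = scale (f [a]) (gen a * diag f v)" for a v
  proof (rule poly_mapping_eqI)
    show "Poly_Mapping.lookup (diag f (gen a * v)) w =
        Poly_Mapping.lookup (scale (f [a]) (gen a * diag f v)) w" for w
      using f_Cons[of a "tl w"] by (cases w) (auto simp: lookup_gen_mult)
  qed
  show "diag f (word u \<star> word v) = diag f (word u) \<star> diag f (word v)" for u v
  proof (induction u arbitrary: v)
    case Nil
    show ?case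
      by (simp add: f_Nil)
  next
    case u: (Cons a u)
    show ?case
    proof (induction v)
      case (Cons b v)
      from this show ?case
        using u[of "b # v"]
        by (simp add: star_Cons lin_add[OF lin_diag] lin_scale[OF lin_diag] gen_mult
            f_Cons[of a u] f_Cons[of b v] mult_scale_right mult_ac free_alg.scale_right_distrib)
    qed (simp add: f_Nil)
  qed
qed (intro lin_rules)+


lemma twist_star: "twist a (u \<star> v) = twist a u \<star> twist a v"
  unfolding twist_def
  by (rule diag_star) (simp_all add: algebra_simps flip: q_powi_add)

lemma twist_word: "twist a (word w) = scale (q powi (2 * bal w * sg a)) (word w)"
  by (simp add: twist_def)

text \<open>Induction on the total length: the skew derivation rule turns both sides into three
  terms, each with one of the words shortened.\<close>

lemma star_assoc: "(u \<star> v) \<star> w = u \<star> (v \<star> w)"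
proof (rule lin_eqI[where f = "\<lambda>u. (u \<star> v) \<star> w"])
  fix u
  show "(word u \<star> v) \<star> w = word u \<star> (v \<star> w)"
  proof (rule bilin_eqI[where f = "\<lambda>v w. (word u \<star> v) \<star> w"])
    fix v w
    show "(word u \<star> word v) \<star> word w = word u \<star> (word v \<star> word w)"
    proof (induction "length u + length v + length w" arbitrary: u v w rule: less_induct)
      case less
      show ?case
      proof (rule counit_strip_eqI)
        fix a
        have u: "(strip_first a (word u) \<star> word v) \<star> word w =
            strip_first a (word u) \<star> (word v \<star> word w)"
          using less by (cases u) (auto simp: strip_first_word)
        have v: "(word u \<star> strip_first a (word v)) \<star> word w =
            word u \<star> (strip_first a (word v) \<star> word w)"
          using less by (cases v) (auto simp: strip_first_word)
        have w: "(word u \<star> word v) \<star> strip_first a (word w) =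
            word u \<star> (word v \<star> strip_first a (word w))"
          using less by (cases w) (auto simp: strip_first_word)
        show "strip_first a ((word u \<star> word v) \<star> word w) =
            strip_first a (word u \<star> (word v \<star> word w))"
          by (simp add: strip_first_star twist_star twist_word u v w
              free_alg.scale_right_distrib mult_ac add.assoc)
      qed (simp add: counit_star counit_word)
    qed
  qed (intro lin_rules)+
qed (intro lin_rules)+

section \<open>Multiplication by a single letter, seen from either end of a word\<close>

lemma strip_first_letter: "strip_first a (gen b) = (if a = b then word [] else 0)"
  by (simp add: strip_first_word)

lemma strip_first_letter_star:
  "strip_first a (gen c \<star> v) =
    (if a = c then v else 0) + scale (q powi (2 * sg c * sg a)) (gen c \<star> strip_first a v)"
  by (simp add: strip_first_star strip_first_letter twist_word)

lemma strip_first_star_letter: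
  "strip_first a (v \<star> gen c) = strip_first a v \<star> gen c + (if a = c then twist a v else 0)"
  by (simp add: strip_first_star strip_first_letter)

lemma letter_star_Cons:
  "gen c \<star> word (b # v) =
    word (c # b # v) + scale (q powi (2 * sg c * sg b)) (gen b * (gen c \<star> word v))"
  by (simp add: star_Cons)

lemma Cons_star_letter:
  "word (a # u) \<star> gen c =
    gen a * (word u \<star> gen c) + scale (q powi (2 * bal (a # u) * sg c)) (word (c # a # u))"
  by (simp add: star_Cons)

text \<open>The product is defined through first letters. This rule and
  \<open>letter_star_snoc\<close> expose the last letter instead, which gives
  \<open>strip_last\<close> its own derivation rules.\<close>

lemma snoc_star_letter:
  "(v * gen b) \<star> gen c =
    v * gen b * gen c + scale (q powi (2 * sg b * sg c)) ((v \<star> gen c) * gen b)"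
proof (rule lin_eqI[where f = "\<lambda>v. (v * gen b) \<star> gen c"])
  show "(word w * gen b) \<star> gen c = word w * gen b * gen c +
      scale (q powi (2 * sg b * sg c)) ((word w \<star> gen c) * gen b)" for w
  proof (induction w)
    case Nil
    show ?case
      by (simp add: Cons_star_letter)
  next
    case (Cons a w)
    then show ?case
      by (simp add: Cons_star_letter distrib_left distrib_right mult_scale_left mult_scale_right
          free_alg.scale_right_distrib algebra_simps flip: q_powi_add)
  qed
qed (intro lin_rules)+

lemma letter_star_snoc:
  "gen c \<star> word (w @ [b]) = (gen c \<star> word w) * gen b +
      scale (q powi (2 * bal (w @ [b]) * sg c)) (word (w @ [b, c]))"
proof (induction w)
  case Nil
  show ?case
    by (simp add: letter_star_Cons mult.commute mult.left_commute)
next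
  case (Cons a w)
  then show ?case
    by (simp add: letter_star_Cons distrib_left distrib_right mult_scale_left mult_scale_right
        free_alg.scale_right_distrib algebra_simps flip: q_powi_add)
qed

lemma strip_last_star_letter:
  "strip_last a (v \<star> gen c) =
    (if a = c then v else 0) + scale (q powi (2 * sg a * sg c)) (strip_last a v \<star> gen c)"
proof (rule lin_eqI[where f = "\<lambda>v. strip_last a (v \<star> gen c)"])
  show "strip_last a (word w \<star> gen c) = (if a = c then word w else 0) +
      scale (q powi (2 * sg a * sg c)) (strip_last a (word w) \<star> gen c)" for w
  proof (cases w rule: rev_cases)
    case (snoc v b)
    then show ?thesis
      using snoc_star_letter[of "word v" b c]
      by (simp add: lin_add[OF lin_strip_last] lin_scale[OF lin_strip_last]
        strip_last_mult_gen strip_last_word butlast_append)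
  qed (simp add: strip_last_word)
qed (intro lin_rules)+

lemma strip_last_letter_star:
  "strip_last a (gen c \<star> v) = gen c \<star> strip_last a v + (if a = c then twist c v else 0)"
proof (rule lin_eqI[where f = "\<lambda>v. strip_last a (gen c \<star> v)"])
  show "strip_last a (gen c \<star> word w) =
      gen c \<star> strip_last a (word w) + (if a = c then twist c (word w) else 0)" for w
  proof (cases w rule: rev_cases)
    case (snoc v b)
    then show ?thesis
      by (simp add: letter_star_snoc lin_add[OF lin_strip_last] lin_scale[OF lin_strip_last]
        strip_last_mult_gen strip_last_word butlast_append twist_word)
  qed (simp add: strip_last_word twist_word)
qed (intro lin_rules)+

definition reversal :: "'a VV \<Rightarrow> 'a VV"
  where "reversal = lin_ext (\<lambda>w. word (rev w))"

lemma lin_reversal: "lin reversal"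
  by (simp add: reversal_def)

lemma reversal_word: "reversal (word w) = word (rev w)"
  by (simp add: reversal_def)

lemma reversal_gen_mult: "reversal (gen a * v) = reversal v * gen a"
  by (rule lin_eqI) (intro lin_rules lin_comp[OF lin_reversal], intro lin_rules lin_reversal,
      simp add: reversal_word)

text \<open>The form is symmetric, so the first-letter rule for left multiplication mirrors the
  last-letter rule for right multiplication. This transfers homogeneity to right products and
  handles the reversed factor in \<open>Phi\<close>.\<close>

lemma reversal_letter_star: "reversal (gen c \<star> v) = reversal v \<star> gen c"
proof (rule lin_eqI[where f = "\<lambda>v. reversal (gen c \<star> v)"])
  show "reversal (gen c \<star> word w) = reversal (word w) \<star> gen c" for w
  proof (induction w)
    case (Cons b w)
    then show ?case
      using snoc_star_letter[of "word (rev w)" b c]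
      by (simp add: letter_star_Cons lin_add[OF lin_reversal] lin_scale[OF lin_reversal]
          reversal_word reversal_gen_mult mult_ac)
  qed (simp add: reversal_word)
qed (intro lin_rules lin_comp[OF lin_reversal] lin_reversal)+

end

lemma subspace_vimage:
  "lin f \<Longrightarrow> free_alg.subspace S \<Longrightarrow> free_alg.subspace {v. f v \<in> S}"
  by (auto simp: free_alg.subspace_def lin_0 lin_add lin_scale)

lemma subspace_kernel: "lin f \<Longrightarrow> free_alg.subspace {v. f v = 0}"
  by (auto simp: free_alg.subspace_def lin_0 lin_add lin_scale)

lemma strip_first_strip_last: "strip_first a (strip_last b v) = strip_last b (strip_first a v)"
  by (rule poly_mapping_eqI) (simp add: lookup_strip_first lookup_strip_last)

section \<open>Homogeneous elements\<close>

text \<open>Degrees are functions on letters, directly comparable with \<open>count_list\<close>;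
  adding a letter \<open>a\<close> turns \<open>d\<close> into
  \<open>d(a := Suc (d a))\<close>.\<close>

definition homogeneous :: "('g \<Rightarrow> nat) \<Rightarrow> ('g, 'a::field) free_alg \<Rightarrow> bool"
  where "homogeneous d v \<longleftrightarrow> (\<forall>w\<in>Poly_Mapping.keys v. count_list w = d)"

definition component :: "('g \<Rightarrow> nat) \<Rightarrow> ('g, 'a::field) free_alg \<Rightarrow> ('g, 'a) free_alg"
  where "component d = diag (\<lambda>w. if count_list w = d then 1 else 0)"

lemma lin_component: "lin (component d)"
  by (simp add: component_def lin_diag)

lemma homogeneous_iff: "homogeneous d v \<longleftrightarrow> (\<forall>w. count_list w \<noteq> d \<longrightarrow> Poly_Mapping.lookup v w = 0)"
  by (auto simp: homogeneous_def in_keys_iff)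

lemma subspace_homogeneous: "free_alg.subspace {v. homogeneous d v}"
  by (auto simp: free_alg.subspace_def homogeneous_iff lookup_add)

lemma homogeneous_component: "homogeneous d (component d v)"
  by (simp add: homogeneous_iff component_def)

lemma component_homogeneous: "homogeneous d v \<Longrightarrow> component e v = (if d = e then v else 0)"
  by (rule poly_mapping_eqI) (auto simp: homogeneous_iff component_def)

lemma homogeneous_word: "homogeneous (count_list w) (word w)"
  by (simp add: homogeneous_def)

lemma sum_component: "(\<Sum>d\<in>count_list ` Poly_Mapping.keys v. component d v) = v"
proof (rule poly_mapping_eqI)
  fix w
  have "(\<Sum>d\<in>count_list ` Poly_Mapping.keys v. Poly_Mapping.lookup (component d v) w) =
    (\<Sum>d\<in>count_list ` Poly_Mapping.keys v. if d = count_list w then Poly_Mapping.lookup v w else 0)"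
    by (intro sum.cong) (auto simp: component_def)
  also have "\<dots> = Poly_Mapping.lookup v w"
    by (auto simp: in_keys_iff)
  finally show "Poly_Mapping.lookup (\<Sum>d\<in>count_list ` Poly_Mapping.keys v. component d v) w =
    Poly_Mapping.lookup v w"
    by (simp add: lookup_sum)
qed

lemma count_list_Cons_fun: "count_list (a # w) = (count_list w)(a := Suc (count_list w a))"
  by (rule ext) simp

lemma count_list_snoc_fun: "count_list (w @ [a]) = (count_list w)(a := Suc (count_list w a))"
  by (rule ext) simp

lemma fun_upd_Suc_eq_iff: "d(a := Suc (d a)) = e(a := Suc (e a)) \<longleftrightarrow> d = e"
  by (auto simp: fun_eq_iff split: if_splits)

lemma homogeneous_strip_first: "homogeneous (d(a := Suc (d a))) v \<Longrightarrow> homogeneous d (strip_first a v)"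
  by (auto simp: homogeneous_iff lookup_strip_first count_list_Cons_fun fun_upd_Suc_eq_iff)

lemma homogeneous_strip_last: "homogeneous (d(a := Suc (d a))) v \<Longrightarrow> homogeneous d (strip_last a v)"
  by (auto simp: homogeneous_iff lookup_strip_last count_list_snoc_fun fun_upd_Suc_eq_iff)

lemma strip_first_homogeneous_0:
  assumes "homogeneous d v" "d a = 0"
  shows "strip_first a v = 0"
proof (rule poly_mapping_eqI)
  have "count_list (a # w) \<noteq> d" for w
    using assms(2) by (metis count_list.simps(2) Suc_eq_plus1 nat.distinct(1))
  then show "Poly_Mapping.lookup (strip_first a v) w = Poly_Mapping.lookup 0 w" for w
    using assms(1) by (simp add: lookup_strip_first homogeneous_iff del: count_list.simps)
qed

lemma strip_last_homogeneous_0: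
  assumes "homogeneous d v" "d a = 0"
  shows "strip_last a v = 0"
proof (rule poly_mapping_eqI)
  have "count_list (w @ [a]) \<noteq> d" for w
    using assms(2) by (auto simp: count_list_snoc_fun)
  then show "Poly_Mapping.lookup (strip_last a v) w = Poly_Mapping.lookup 0 w" for w
    using assms(1) by (simp add: lookup_strip_last homogeneous_iff del: count_list_append)
qed

lemma homogeneous_gen_mult: "homogeneous d v \<Longrightarrow> homogeneous (d(a := Suc (d a))) (gen a * v)"
  by (auto simp: homogeneous_iff lookup_gen_mult neq_Nil_conv count_list_Cons_fun fun_upd_Suc_eq_iff
      simp del: count_list.simps)

lemma diag_homogeneous:
  assumes "homogeneous d v" "\<And>w. count_list w = d \<Longrightarrow> f w = c"
  shows "diag f v = scale c v"
  by (rule poly_mapping_eqI) (use assms in \<open>auto simp: homogeneous_iff\<close>)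

lemma homogeneous_diag: "homogeneous d v \<Longrightarrow> homogeneous d (diag f v)"
  by (simp add: homogeneous_iff)

lemma homogeneous_add: "homogeneous d u \<Longrightarrow> homogeneous d v \<Longrightarrow> homogeneous d (u + v)"
  and homogeneous_diff: "homogeneous d u \<Longrightarrow> homogeneous d v \<Longrightarrow> homogeneous d (u - v)"
  and homogeneous_scale: "homogeneous d v \<Longrightarrow> homogeneous d (scale c v)"
  by (simp_all add: homogeneous_iff lookup_add lookup_minus)

lemma bal_count: "bal w = int (count_list w Lx) - int (count_list w Ly)"
proof (induction w)
  case (Cons a w)
  then show ?case
    by (cases a) simp_all
qed simp

context quantum
begin

lemma homogeneous_letter_star:
  assumes "homogeneous d v"
  shows "homogeneous (d(a := Suc (d a))) (gen a \<star> v)"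
proof -
  have w: "homogeneous ((count_list w)(a := Suc (count_list w a))) (gen a \<star> word w)" for w
  proof (induction w)
    case Nil
    show ?case
      using homogeneous_word[of "[a]"] unfolding star_Nil_right count_list_Cons_fun .
  next
    case (Cons b w)
    let ?d = "(count_list (b # w))(a := Suc (count_list (b # w) a))"
    have "?d = ((count_list w)(a := Suc (count_list w a)))
        (b := Suc (((count_list w)(a := Suc (count_list w a))) b))"
      by (rule ext) simp
    then have "homogeneous ?d (gen b * (gen a \<star> word w))"
      using homogeneous_gen_mult[OF Cons, of b] by (simp only:)
    moreover have "homogeneous ?d (word (a # b # w))"
      using homogeneous_word[of "a # b # w"] by (simp only: count_list_Cons_fun[of a "b # w"])
    ultimately show ?case
      unfolding letter_star_Cons by (intro homogeneous_add homogeneous_scale)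
  qed
  have "gen a \<star> v = lin_ext (\<lambda>w. gen a \<star> word w) v"
    by (rule lin_eq_lin_ext) (intro lin_rules)
  also have "\<dots> \<in> {v. homogeneous (d(a := Suc (d a))) v}"
    using assms w by (intro lin_ext_in_subspace subspace_homogeneous) (auto simp: homogeneous_def)
  finally show ?thesis by simp
qed

lemma homogeneous_reversal: "homogeneous d v \<Longrightarrow> homogeneous d (reversal v)"
proof -
  have "count_list (rev w) = count_list w" for w :: "letter list"
    by (rule ext) simp
  then show "homogeneous d v \<Longrightarrow> homogeneous d (reversal v)"
    using lin_ext_in_subspace[OF subspace_homogeneous, of v "\<lambda>w. word (rev w)" d]
    unfolding reversal_def by (auto simp: homogeneous_def)
qed

lemma reversal_reversal: "reversal (reversal v) = v"
  by (rule lin_eqI) (intro lin_rules lin_comp[OF lin_reversal] lin_reversal, intro lin_rules,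
      simp add: reversal_word)

lemma homogeneous_star_letter: "homogeneous d v \<Longrightarrow> homogeneous (d(a := Suc (d a))) (v \<star> gen a)"
  using homogeneous_reversal[OF homogeneous_letter_star[OF homogeneous_reversal], of d v a]
  by (simp add: reversal_letter_star reversal_reversal)

section \<open>The subalgebra generated by the letters\<close>

primrec mono :: "letter list \<Rightarrow> 'a VV"
  where
    "mono [] = word []"
  | "mono (a # ws) = gen a \<star> mono ws"

lemma qshuffle_subalgebra_UU: "qshuffle_subalgebra q (UU q)"
  unfolding UU_def
  by (rule hull_in) (auto simp: qshuffle_subalgebra_def intro: free_alg.subspace_Inter)

lemma subspace_UU: "free_alg.subspace (UU q)"
  and Nil_in_UU: "word [] \<in> UU q"
  and star_in_UU: "u \<in> UU q \<Longrightarrow> v \<in> UU q \<Longrightarrow> u \<star> v \<in> UU q"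
  using qshuffle_subalgebra_UU by (auto simp: qshuffle_subalgebra_def star_def)

lemma gen_in_UU: "gen a \<in> UU q"
  using hull_subset[of "{gen Lx, gen Ly}" "qshuffle_subalgebra q"] by (cases a) (auto simp: UU_def)

lemma mono_in_UU: "mono ws \<in> UU q"
  by (induction ws) (auto intro: Nil_in_UU star_in_UU gen_in_UU)

lemma mono_append: "mono (us @ ws) = mono us \<star> mono ws"
  by (induction us) (simp_all add: star_assoc)

text \<open>Products of letters multiply by concatenating their index lists, so their span is
  already closed under the product.\<close>

lemma UU_eq_span: "UU q = free_alg.span (range mono)"
proof
  let ?S = "free_alg.span (range mono)"
  show "?S \<subseteq> UU q"
    by (rule free_alg.span_minimal) (auto intro: mono_in_UU subspace_UU)
  have mono: "mono ws \<in> ?S" for ws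
    by (intro free_alg.span_base) simp
  have gen: "gen a \<in> ?S" for a
    using mono[of "[a]"] by simp
  have "mono us \<star> v \<in> ?S" if "v \<in> ?S" for us v
  proof -
    have "?S \<subseteq> {v. mono us \<star> v \<in> ?S}"
      by (intro free_alg.span_minimal subspace_vimage[OF lin_star_right])
        (use mono in \<open>auto simp flip: mono_append\<close>)
    then show ?thesis using that by auto
  qed
  then have "u \<star> v \<in> ?S" if "u \<in> ?S" "v \<in> ?S" for u v
    using that free_alg.span_minimal[of "range mono" "{u. u \<star> v \<in> ?S}"]
      subspace_vimage[OF lin_star_left free_alg.subspace_span]
    by (auto simp: subset_iff)
  then have "qshuffle_subalgebra q ?S"
    using mono[of "[]"] by (simp add: qshuffle_subalgebra_def star_def)
  then show "UU q \<subseteq> ?S"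
    unfolding UU_def by (rule hull_minimal[rotated]) (simp add: gen)
qed

text \<open>Left multiplication by letters reaches a spanning set from \<open>word []\<close>, so a
  linear condition need only be carried through that one step.\<close>

lemma UU_induct:
  assumes "v \<in> UU q" "free_alg.subspace {v. P v}" "P (word [])"
    and step: "\<And>a v. v \<in> UU q \<Longrightarrow> P v \<Longrightarrow> P (gen a \<star> v)"
  shows "P v"
proof -
  have "P (mono ws)" for ws
    by (induction ws) (simp_all add: assms step mono_in_UU)
  then have "UU q \<subseteq> {v. P v}"
    unfolding UU_eq_span by (intro free_alg.span_minimal assms) auto
  then show ?thesis using assms(1) by auto
qed

lemma strip_first_in_UU:
  assumes "v \<in> UU q"
  shows "strip_first a v \<in> UU q"
  using assms
proof (rule UU_induct)
  show "strip_first a (word []) \<in> UU q"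
    by (simp add: strip_first_word free_alg.subspace_0[OF subspace_UU])
  show "strip_first a (gen c \<star> v) \<in> UU q" if "v \<in> UU q" "strip_first a v \<in> UU q" for c v
    using that by (auto simp: strip_first_letter_star intro!: star_in_UU gen_in_UU
        free_alg.subspace_add[OF subspace_UU] free_alg.subspace_scale[OF subspace_UU])
qed (rule subspace_vimage[OF lin_strip_first subspace_UU])

lemma component_in_UU:
  assumes "v \<in> UU q"
  shows "component d v \<in> UU q"
proof -
  have "homogeneous (count_list ws) (mono ws)" for ws
  proof (induction ws)
    case (Cons a ws)
    then show ?case
      using homogeneous_letter_star[OF Cons, of a] by (simp only: mono.simps count_list_Cons_fun)
  qed (simp only: mono.simps homogeneous_word)
  then have "component d (mono ws) \<in> UU q" for ws
    using component_homogeneous[of "count_list ws" "mono ws" d]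
    by (auto intro: mono_in_UU free_alg.subspace_0[OF subspace_UU])
  then have "free_alg.span (range mono) \<subseteq> {v. component d v \<in> UU q}"
    by (intro free_alg.span_minimal subspace_vimage[OF lin_component] subspace_UU) auto
  then have "UU q \<subseteq> {v. component d v \<in> UU q}"
    by (simp only: UU_eq_span)
  then show ?thesis using assms by auto
qed

section \<open>The q-Serre relations for the removal of first letters\<close>

definition serre :: "letter \<Rightarrow> letter \<Rightarrow> 'a VV \<Rightarrow> 'a VV"
  where "serre b a v =
    strip_first b (strip_first b (strip_first b (strip_first a v)))
    - scale (q powi 2 + 1 + q powi -2) (strip_first b (strip_first b (strip_first a (strip_first b v))))
    + scale (q powi 2 + 1 + q powi -2) (strip_first b (strip_first a (strip_first b (strip_first b v))))
    - strip_first a (strip_first b (strip_first b (strip_first b v)))"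

lemma lin_serre: "lin (serre b a)"
  unfolding serre_def by (intro lin_rules)

text \<open>The coefficient in \<open>serre\<close> is the q-integer [3]. With it, all terms in
  which some strip removes the factor \<open>gen c\<close> cancel. In the others all four strips
  pass \<open>gen c\<close>, which costs q to the power (c, 3b + a).\<close>

lemma serre_letter_star:
  assumes "a \<noteq> b"
  shows "serre b a (gen c \<star> v) = scale (if b = c then q powi 4 else q powi -4) (gen c \<star> serre b a v)"
proof -
  have lin: "strip_first e (u + v) = strip_first e u + strip_first e v"
    "strip_first e (scale k v) = scale k (strip_first e v)" for e u k and v :: "'a VV"
    by (simp_all add: lin_add lin_scale lin_strip_first)
  \<comment> \<open>Writing the powers of q in terms of \<open>p\<close> and \<open>r\<close> with
    \<open>p * r = 1\<close> leaves a polynomial identity between coefficients.\<close>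
  define p where "p = q powi 2"
  define r where "r = q powi (-2)"
  have pr: "p * r = 1"
    unfolding p_def r_def q_powi_add[symmetric] by simp
  then have pr': "p * (r * z) = z" for z
    by (metis mult.assoc mult_1)
  have p2: "q powi 4 = p * p" "q powi (-4) = r * r"
    unfolding p_def r_def q_powi_add[symmetric] by simp_all
  have sg: "sg b * sg a = -1" "sg a * sg b = -1"
    using assms by (cases a; cases b; simp)+
  have "c = a \<or> c = b"
    using assms by (cases a; cases b; cases c) simp_all
  then show ?thesis
  proof
    assume c: "c = b"
    have strip: "strip_first b (gen b \<star> u) = u + scale p (gen b \<star> strip_first b u)"
      "strip_first a (gen b \<star> u) = scale r (gen b \<star> strip_first a u)" for u
      using assms sg by (simp_all add: strip_first_letter_star p_def r_def mult.assoc)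
    show ?thesis
    proof (rule poly_mapping_eqI)
      show "Poly_Mapping.lookup (serre b a (gen c \<star> v)) w = Poly_Mapping.lookup
          (scale (if b = c then q powi 4 else q powi -4) (gen c \<star> serre b a v)) w" for w
        unfolding serre_def c p2 p_def[symmetric] r_def[symmetric]
        by (simp add: assms assms[symmetric] lin strip lookup_add lookup_minus algebra_simps pr pr')
    qed
  next
    assume c: "c = a"
    have strip: "strip_first b (gen a \<star> u) = scale r (gen a \<star> strip_first b u)"
      "strip_first a (gen a \<star> u) = u + scale p (gen a \<star> strip_first a u)" for u
      using assms sg by (simp_all add: strip_first_letter_star p_def r_def mult.assoc)
    show ?thesis
    proof (rule poly_mapping_eqI)
      show "Poly_Mapping.lookup (serre b a (gen c \<star> v)) w = Poly_Mapping.lookup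
          (scale (if b = c then q powi 4 else q powi -4) (gen c \<star> serre b a v)) w" for w
        unfolding serre_def c p2 p_def[symmetric] r_def[symmetric]
        by (simp add: assms assms[symmetric] lin strip lookup_add lookup_minus algebra_simps pr pr')
    qed
  qed
qed

lemma serre_UU:
  assumes "v \<in> UU q" "a \<noteq> b"
  shows "serre b a v = 0"
  using assms(1)
proof (rule UU_induct)
  show "serre b a (word []) = 0"
    by (simp add: serre_def strip_first_word lin_0[OF lin_strip_first])
qed (simp_all add: subspace_kernel lin_serre serre_letter_star assms(2))

section \<open>Degree bounds from the Serre relations\<close>

lemma lin_funpow:
  fixes f :: "'a VV \<Rightarrow> 'a VV"
  shows "lin f \<Longrightarrow> lin (f ^^ n)"
  by (rule linI; induction n) (simp_all add: lin_add lin_scale)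

lemma funpow_strip_first_in_UU: "v \<in> UU q \<Longrightarrow> (strip_first a ^^ n) v \<in> UU q"
  by (induction n) (simp_all add: strip_first_in_UU)

text \<open>The Serre relation rewrites three strips of \<open>b\<close> following one of
  \<open>a\<close> as terms in which some \<open>b\<close> is stripped before \<open>a\<close>.
  There v is replaced by \<open>(strip_first b ^^ j) v\<close> with j > 0, which a smaller power
  kills, so the induction applies.\<close>

lemma strip_first_nilpotent_step:
  assumes "v \<in> UU q" "a \<noteq> b" "(strip_first b ^^ k) v = 0"
  shows "(strip_first b ^^ (k + 2)) (strip_first a v) = 0"
  using assms(1,3)
proof (induction k arbitrary: v rule: less_induct)
  case (less k)
  let ?b = "strip_first b" and ?a = "strip_first a" and ?t = "q powi 2 + 1 + q powi -2"
  note lin_b = lin_funpow[OF lin_strip_first, of _ b]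
  \<comment> \<open>Each of the three Serre terms has this shape, with
    \<open>m + j = k + 2\<close>.\<close>
  have shift: "(?b ^^ m) (?a ((?b ^^ j) v)) = 0" if "0 < j" "k + 2 \<le> m + j" for j m
  proof (cases "j \<le> k")
    case True
    have "(?b ^^ (k - j)) ((?b ^^ j) v) = 0"
      using True less.prems by (simp flip: funpow_add[THEN fun_cong, unfolded o_apply])
    then have "(?b ^^ (k - j + 2)) (?a ((?b ^^ j) v)) = 0"
      using that True less.prems by (intro less.IH) (auto intro: funpow_strip_first_in_UU)
    moreover have "m = (m - (k - j + 2)) + (k - j + 2)"
      using that True by simp
    ultimately show ?thesis
      by (metis funpow_add o_apply lin_0 lin_b)
  next
    case False
    then have "(?b ^^ j) v = (?b ^^ (j - k)) ((?b ^^ k) v)"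
      by (simp flip: funpow_add[THEN fun_cong, unfolded o_apply])
    then show ?thesis
      using less.prems by (simp add: lin_0 lin_b lin_strip_first)
  qed
  show ?case
  proof (cases k)
    case 0
    then show ?thesis
      using less.prems by (simp add: lin_0 lin_strip_first)
  next
    case (Suc n)
    have "?b (?b (?b (?a v))) = scale ?t (?b (?b (?a (?b v)))) - scale ?t (?b (?a (?b (?b v))))
        + ?a (?b (?b (?b v)))"
      using serre_UU[OF less.prems(1) assms(2)] by (simp add: serre_def algebra_simps)
    then have "(?b ^^ n) (?b (?b (?b (?a v)))) =
        scale ?t ((?b ^^ n) (?b (?b (?a (?b v))))) - scale ?t ((?b ^^ n) (?b (?a (?b (?b v)))))
        + (?b ^^ n) (?a (?b (?b (?b v))))"
      by (simp only: lin_add[OF lin_b] lin_diff[OF lin_b] lin_scale[OF lin_b])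
    also have "\<dots> = 0"
      using shift[of 1 "n + 2"] shift[of 2 "n + 1"] shift[of 3 n] Suc
      by (simp add: numeral_2_eq_2 numeral_3_eq_3 funpow_swap1)
    finally show ?thesis
      using Suc by (simp add: numeral_2_eq_2 funpow_swap1)
  qed
qed

text \<open>The inequality is inherited: stripping \<open>b\<close> lowers k and \<open>d b\<close>
  by one, and stripping \<open>a\<close> raises k by two while it lowers \<open>d a\<close> by one.
  So for k > 0 both strips of v vanish by induction, and v has no constant term because
  \<open>d b > 0\<close>.\<close>

lemma strip_first_nilpotent_degree:
  assumes "v \<in> UU q" "a \<noteq> b" "homogeneous d v" "(strip_first b ^^ k) v = 0" "k + 2 * d a \<le> d b"
  shows "v = 0"
  using assms(1,3-5)
proof (induction "d a + d b" arbitrary: d v k rule: less_induct)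
  case less
  show ?case
  proof (cases k)
    case (Suc n)
    have b: "strip_first b v = 0"
    proof (rule less.hyps)
      let ?d = "d(b := d b - 1)"
      show "homogeneous ?d (strip_first b v)"
        using Suc less.prems by (intro homogeneous_strip_first) auto
      show "(strip_first b ^^ n) (strip_first b v) = 0"
        using Suc less.prems by (simp add: funpow_swap1)
    qed (use Suc less.prems assms(2) in \<open>auto intro: strip_first_in_UU\<close>)
    have a: "strip_first a v = 0"
    proof (cases "d a = 0")
      case False
      let ?d = "d(a := d a - 1)"
      show ?thesis
      proof (rule less.hyps)
        show "homogeneous ?d (strip_first a v)"
          using False less.prems by (intro homogeneous_strip_first) auto
        show "(strip_first b ^^ (k + 2)) (strip_first a v) = 0"
          using less.prems assms(2) by (intro strip_first_nilpotent_step) auto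
      qed (use False less.prems assms(2) in \<open>auto intro: strip_first_in_UU\<close>)
    qed (use less.prems strip_first_homogeneous_0 in auto)
    show ?thesis
    proof (rule strip_eqI)
      have "count_list [] \<noteq> d"
        using Suc less.prems(4) by auto
      then show "Poly_Mapping.lookup v [] = Poly_Mapping.lookup 0 []"
        using less.prems(2) by (simp add: homogeneous_iff)
      show "strip_first c v = strip_first c 0" for c
        using a b assms(2) by (cases a; cases b; cases c) (simp_all add: lin_0 lin_strip_first)
    qed
  qed (use less.prems in simp)
qed

end

section \<open>Splittings of words\<close>

text \<open>This is the deconcatenation coproduct of a word followed by \<open>G\<close>. The
  recursion makes its interplay with the product an induction on the word.\<close>

primrec spl :: "'g list \<Rightarrow> ('g list \<Rightarrow> 'g list \<Rightarrow> 'b) \<Rightarrow> 'b::comm_monoid_add"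
  where
    "spl [] G = G [] []"
  | "spl (a # w) G = G [] (a # w) + spl w (\<lambda>u. G (a # u))"

lemma spl_snoc: "spl (w @ [a]) G = spl w (\<lambda>u v. G u (v @ [a])) + G (w @ [a]) []"
  by (induction w arbitrary: G) (simp_all add: add.assoc)

lemma spl_cong:
  "(\<And>u v. u @ v = w \<Longrightarrow> G u v = H u v) \<Longrightarrow> spl w G = spl w H"
proof (induction w arbitrary: G H)
  case (Cons a w)
  have "spl w (\<lambda>u. G (a # u)) = spl w (\<lambda>u. H (a # u))"
    by (rule Cons.IH) (simp add: Cons.prems)
  then show ?case
    by (simp add: Cons.prems)
qed simp

lemma spl_add: "spl w (\<lambda>u v. G u v + H u v) = spl w G + spl w H"
  by (induction w arbitrary: G H) (simp_all add: ac_simps)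

lemma spl_0: "spl w (\<lambda>u v. 0) = 0"
  by (induction w) simp_all

lemma lin_spl: "lin f \<Longrightarrow> f (spl w G) = spl w (\<lambda>u v. f (G u v))"
  by (induction w arbitrary: G) (simp_all add: lin_add)

lemma spl_coassoc: "spl w (\<lambda>u v. spl v (H u)) = spl w (\<lambda>u v. spl u (\<lambda>x y. H x y v))"
  by (induction w arbitrary: H) (simp_all add: spl_add add.assoc)

lemma spl_Nil_left: "spl w (\<lambda>u v. if u = [] then G v else 0) = G w"
  by (cases w) (simp_all add: spl_0)

lemma spl_conv_sum:
  "finite {p. fst p @ snd p = w} \<and> spl w G = (\<Sum>p\<in>{p. fst p @ snd p = w}. G (fst p) (snd p))"
proof (induction w arbitrary: G)
  case Nil
  have *: "{p. fst p @ snd p = []} = {([], [])}"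
    by auto
  show ?case
    unfolding * by simp
next
  case (Cons a w)
  let ?P = "\<lambda>w. {p. fst p @ snd p = w}"
  have "?P (a # w) = insert ([], a # w) ((\<lambda>p. (a # fst p, snd p)) ` ?P w)"
    by (auto simp: append_eq_Cons_conv image_iff)
  moreover have "inj_on (\<lambda>p. (a # fst p, snd p)) (?P w)"
    by (auto simp: inj_on_def prod_eq_iff)
  ultimately show ?case
    using Cons[of "\<lambda>u. G (a # u)"] by (auto simp: sum.reindex image_iff)
qed

section \<open>Membership of deconcatenation sums in a subspace\<close>

lemma lin_ext_spl_conv_sum:
  assumes "finite V1" "finite V2" "\<And>u v. u @ v \<in> Poly_Mapping.keys z \<Longrightarrow> u \<in> V1 \<and> v \<in> V2"
  shows "lin_ext (\<lambda>w. spl w G) z =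
    (\<Sum>u\<in>V1. \<Sum>v\<in>V2. scale (Poly_Mapping.lookup z (u @ v)) (G u v))"
proof -
  let ?P = "{p. fst p @ snd p \<in> Poly_Mapping.keys z}"
  let ?h = "\<lambda>p. scale (Poly_Mapping.lookup z (fst p @ snd p)) (G (fst p) (snd p))"
  have P: "?P \<subseteq> V1 \<times> V2"
    using assms(3) by auto
  then have fin: "finite ?P"
    by (rule finite_subset) (simp add: assms)
  have "lin_ext (\<lambda>w. spl w G) z =
      (\<Sum>w\<in>Poly_Mapping.keys z. \<Sum>p\<in>{p. fst p @ snd p = w}. ?h p)"
    unfolding lin_ext_def by (intro sum.cong) (simp_all add: spl_conv_sum free_alg.scale_sum_right)
  also have "\<dots> = (\<Sum>w\<in>Poly_Mapping.keys z. \<Sum>p\<in>{p \<in> ?P. fst p @ snd p = w}. ?h p)"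
    by (intro sum.cong) auto
  also have "\<dots> = (\<Sum>p\<in>?P. ?h p)"
    by (rule sum.group) (use fin in auto)
  also have "\<dots> = (\<Sum>p\<in>V1 \<times> V2. ?h p)"
    using P assms by (intro sum.mono_neutral_left) (auto simp: in_keys_iff)
  finally show ?thesis
    by (simp add: sum.cartesian_product case_prod_beta)
qed

text \<open>
  The hypotheses say that the tensor \<open>\<Sum> M x y \<cdot> x \<otimes> y\<close> lies in \<open>U \<otimes> V\<close> and in \<open>V \<otimes> Z\<close>;
  expanding the right factors in a basis of \<open>Z\<close> shows that it lies in \<open>U \<otimes> Z\<close>.
\<close>

lemma tensor_in_subspace:
  fixes U Z :: "('g, 'a::field) free_alg set" and T :: "('h, 'a) free_alg set"
  assumes lin: "\<And>u. lin (\<lambda>z. \<Theta> z u)" "\<And>z. lin (\<lambda>u. \<Theta> z u)"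
    and fin: "finite V1" "finite V2"
    and sub: "free_alg.subspace U" "free_alg.subspace Z" "free_alg.subspace T"
    and U: "\<And>y. y \<in> V2 \<Longrightarrow> (\<Sum>x\<in>V1. scale (M x y) (word x)) \<in> U"
    and Z: "\<And>x. x \<in> V1 \<Longrightarrow> (\<Sum>y\<in>V2. scale (M x y) (word y)) \<in> Z"
    and T: "\<And>z u. z \<in> Z \<Longrightarrow> u \<in> U \<Longrightarrow> \<Theta> z u \<in> T"
  shows "(\<Sum>x\<in>V1. \<Sum>y\<in>V2. scale (M x y) (\<Theta> (word y) (word x))) \<in> T"
proof -
  obtain B where B: "B \<subseteq> Z" "free_alg.independent B" "Z \<subseteq> free_alg.span B"
    using free_alg.maximal_independent_subset by blast
  \<comment> \<open>A single \<open>word y\<close> need not lie in \<open>Z\<close>. Coordinates on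
    the whole space make \<open>r\<close> linear in all words, and on the vectors \<open>z x\<close>
    they agree with those in \<open>B\<close>.\<close>
  define E where "E = free_alg.extend_basis B"
  define r where "r = free_alg.representation E"
  have E: "free_alg.independent E" "free_alg.span E = UNIV" "B \<subseteq> E"
    unfolding E_def by (intro B free_alg.independent_extend_basis free_alg.span_extend_basis
      free_alg.extend_basis_superset)+
  define z where "z x = (\<Sum>y\<in>V2. scale (M x y) (word y))" for x
  define F where "F = (\<Union>x\<in>V1. {b. r (z x) b \<noteq> 0})"
  have finF: "finite F"
    unfolding F_def r_def using fin free_alg.finite_representation by auto
  have r_B: "r (z x) = free_alg.representation B (z x)" if "x \<in> V1" for x
    unfolding r_def using that E B Z
    by (intro free_alg.representation_extend) (auto simp: z_def)
  then have "F \<subseteq> B"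
    unfolding F_def using free_alg.representation_ne_zero by fastforce
  then have FZ: "F \<subseteq> Z"
    using B by auto
  have z_expand: "z x = (\<Sum>b\<in>F. scale (r (z x) b) b)" if "x \<in> V1" for x
  proof -
    have "(\<Sum>b\<in>F. scale (r (z x) b) b) = (\<Sum>b\<in>{b. r (z x) b \<noteq> 0}. scale (r (z x) b) b)"
      using that finF by (intro sum.mono_neutral_right) (auto simp: F_def)
    also have "\<dots> = z x"
      unfolding r_def using E by (intro free_alg.sum_nonzero_representation_eq) auto
    finally show ?thesis ..
  qed
  have r_lin: "r (z x) b = (\<Sum>y\<in>V2. M x y * r (word y) b)" for x b
    unfolding z_def r_def using E
    by (simp add: free_alg.representation_sum free_alg.representation_scale)
  \<comment> \<open>\<open>u b\<close> is the left factor of the tensor that belongs to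
    \<open>b\<close>; expressed through the columns of \<open>M\<close> it lies in
    \<open>U\<close>.\<close>
  define u where "u b = (\<Sum>x\<in>V1. scale (r (z x) b) (word x))" for b
  have "u b = (\<Sum>y\<in>V2. scale (r (word y) b) (\<Sum>x\<in>V1. scale (M x y) (word x)))" for b
    unfolding u_def r_lin free_alg.scale_sum_left free_alg.scale_sum_right
    by (subst sum.swap) (simp add: mult.commute)
  then have uU: "u b \<in> U" for b
    by (simp add: free_alg.subspace_sum free_alg.subspace_scale sub U)
  have "(\<Sum>x\<in>V1. \<Sum>y\<in>V2. scale (M x y) (\<Theta> (word y) (word x))) = (\<Sum>x\<in>V1. \<Theta> (z x) (word x))"
    unfolding z_def by (simp add: lin_sum[OF lin(1)] lin_scale[OF lin(1)])
  also have "\<dots> = (\<Sum>x\<in>V1. \<Sum>b\<in>F. \<Theta> b (scale (r (z x) b) (word x)))"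
    by (intro sum.cong refl, subst z_expand)
      (simp_all add: lin_sum[OF lin(1)] lin_scale[OF lin(1)] lin_scale[OF lin(2)])
  also have "\<dots> = (\<Sum>b\<in>F. \<Theta> b (u b))"
    unfolding u_def by (subst sum.swap) (simp add: lin_sum[OF lin(2)])
  also have "\<dots> \<in> T"
    using FZ uU by (intro free_alg.subspace_sum sub T) auto
  finally show ?thesis .
qed

text \<open>The coefficients of v at \<open>x @ y\<close> form a matrix. The column at a nonempty y
  arises from v by removing y on the right, the row at x by removing x on the left. The column at
  the empty y would be v itself, which is not assumed to lie in \<open>U\<close>.\<close>

lemma spl_in_subspace:
  fixes v :: "'a::field VV" and T :: "('h, 'a) free_alg set"
  assumes lin: "\<And>u. lin (\<lambda>z. \<Theta> z u)" "\<And>z. lin (\<lambda>u. \<Theta> z u)"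
    and sub: "free_alg.subspace U" "free_alg.subspace Z" "free_alg.subspace T"
    and U: "\<And>a. strip_last a v \<in> U" "\<And>a u. u \<in> U \<Longrightarrow> strip_last a u \<in> U"
    and Z: "v \<in> Z" "word [] \<in> Z" "\<And>a z. z \<in> Z \<Longrightarrow> strip_first a z \<in> Z"
    and T: "\<And>z u. z \<in> Z \<Longrightarrow> u \<in> U \<Longrightarrow> \<Theta> z u \<in> T"
  shows "lin_ext (\<lambda>w. spl w (\<lambda>x y. if y = [] then 0 else \<Theta> (word y) (word x))) v \<in> T"
proof -
  let ?v = "Poly_Mapping.lookup v"
  let ?n = "Max (length ` Poly_Mapping.keys v)"
  define V where "V = {w :: letter list. length w \<le> ?n}"
  have "finite (UNIV :: letter set)"
    by (rule finite_subset[of _ "{Lx, Ly}"]) (use letter.exhaust in auto)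
  then have V: "finite V"
    unfolding V_def using finite_lists_length_le[of UNIV ?n] by simp
  have in_V: "x \<in> V" "y \<in> V" if "?v (x @ y) \<noteq> 0" for x y
  proof -
    have "length (x @ y) \<le> ?n"
      using that by (intro Max_ge imageI) (auto simp: in_keys_iff)
    then show "x \<in> V" "y \<in> V"
      by (simp_all add: V_def)
  qed
  have lookup_comb: "Poly_Mapping.lookup (\<Sum>x\<in>S. scale (f x) (word x)) w = (if w \<in> S then f w else 0)"
    if "finite S" for S :: "letter list set" and f :: "letter list \<Rightarrow> 'a" and w
    using that by (simp add: lookup_sum lookup_word when_def if_distrib[of "\<lambda>x. _ * x"] cong: if_cong)
  have "lin_ext (\<lambda>w. spl w (\<lambda>x y. if y = [] then 0 else \<Theta> (word y) (word x))) v =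
      (\<Sum>x\<in>V. \<Sum>y\<in>V. scale (?v (x @ y)) (if y = [] then 0 else \<Theta> (word y) (word x)))"
    using V in_V by (intro lin_ext_spl_conv_sum) (auto simp: in_keys_iff)
  also have "\<dots> = (\<Sum>x\<in>V. \<Sum>y\<in>V - {[]}. scale (?v (x @ y)) (\<Theta> (word y) (word x)))"
    using V by (intro sum.cong sum.mono_neutral_cong_right) auto
  also have "\<dots> \<in> T"
  proof (rule tensor_in_subspace[OF lin V _ sub _ _ T])
    fix y assume "y \<in> V - {[]}"
    then have "y \<noteq> []" by simp
    then have "\<exists>u\<in>U. \<forall>w. Poly_Mapping.lookup u w = ?v (w @ y)"
    proof (induction y rule: list_nonempty_induct)
      case (single a)
      then show ?case
        using U(1)[of a] by (intro bexI[of _ "strip_last a v"]) (auto simp: lookup_strip_last)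
    next
      case (cons a y)
      then obtain u where "u \<in> U" "\<And>w. Poly_Mapping.lookup u w = ?v (w @ y)"
        by auto
      then show ?case
        using U(2)[of u a] by (intro bexI[of _ "strip_last a u"]) (auto simp: lookup_strip_last)
    qed
    then obtain u where u: "u \<in> U" "\<And>w. Poly_Mapping.lookup u w = ?v (w @ y)"
      by auto
    have "(\<Sum>x\<in>V. scale (?v (x @ y)) (word x)) = u"
      using in_V by (intro poly_mapping_eqI) (auto simp: lookup_comb V u)
    then show "(\<Sum>x\<in>V. scale (?v (x @ y)) (word x)) \<in> U"
      using u by simp
  next
    fix x
    have "\<exists>z\<in>Z. \<forall>w. Poly_Mapping.lookup z w = ?v (x @ w)"
    proof (induction x rule: rev_induct)
      case Nil
      then show ?case
        using Z(1) by auto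
    next
      case (snoc a x)
      then obtain z where "z \<in> Z" "\<And>w. Poly_Mapping.lookup z w = ?v (x @ w)"
        by auto
      then show ?case
        using Z(3)[of z a] by (intro bexI[of _ "strip_first a z"]) (auto simp: lookup_strip_first)
    qed
    then obtain z where z: "z \<in> Z" "\<And>w. Poly_Mapping.lookup z w = ?v (x @ w)"
      by auto
    \<comment> \<open>Leaving out the empty y removes the constant term from the row; the row stays
      in \<open>Z\<close> because \<open>word []\<close> does.\<close>
    have "(\<Sum>y\<in>V - {[]}. scale (?v (x @ y)) (word y)) = z - scale (?v x) (word [])"
      using in_V V by (intro poly_mapping_eqI)
        (auto simp: lookup_comb lookup_minus lookup_word when_def z)
    then show "(\<Sum>y\<in>V - {[]}. scale (?v (x @ y)) (word y)) \<in> Z"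
      using z Z sub by (simp add: free_alg.subspace_diff free_alg.subspace_scale)
  qed (use V in simp)
  finally show ?thesis .
qed

text \<open>The letters x and y stand for the nodes 0 and 1, and \<open>lam\<close> gives the
  exponents of q by which K_0 and K_1 act on the empty word.\<close>

fun lam :: "letter \<Rightarrow> int"
  where "lam Lx = 1" | "lam Ly = 0"

definition wlam :: "letter list \<Rightarrow> int"
  where "wlam w = (\<Sum>a\<leftarrow>w. lam a)"

lemma wlam_simps [simp]:
  "wlam [] = 0" "wlam (a # w) = lam a + wlam w" "wlam (u @ w) = wlam u + wlam w"
  by (simp_all add: wlam_def)

lemma wlam_count: "wlam w = int (count_list w Lx)"
proof (induction w)
  case (Cons a w)
  then show ?case
    by (cases a) simp_all
qed simp

lemma length_count: "length w = count_list w Lx + count_list w Ly"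
proof (induction w)
  case (Cons a w)
  then show ?case
    by (cases a) simp_all
qed simp

context quantum
begin

section \<open>The lowering operators\<close>

definition shift :: "int \<Rightarrow> 'a VV \<Rightarrow> 'a VV"
  where "shift k = diag (\<lambda>w. q powi (k * bal w))"

lemma lin_shift: "lin (shift k)"
  by (simp add: shift_def lin_diag)

lemma shift_word [simp]: "shift k (word w) = scale (q powi (k * bal w)) (word w)"
  by (simp add: shift_def)

lemma shift_star: "shift k (u \<star> v) = shift k u \<star> shift k v"
  unfolding shift_def
  by (rule diag_star) (simp_all add: algebra_simps flip: q_powi_add)

lemma shift_shift: "shift k (shift l v) = shift (k + l) v"
  by (simp add: shift_def diag_diag distrib_right flip: q_powi_add)

lemma shift_0: "shift 0 v = v"
  by (simp add: shift_def diag_one)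

lemma twist_shift: "twist a = shift (2 * sg a)"
  by (simp add: twist_def shift_def mult_ac)

lemma strip_first_shift: "strip_first a (shift k v) = scale (q powi (k * sg a)) (shift k (strip_first a v))"
  by (simp add: shift_def strip_first_diag distrib_left q_powi_add diag_scale_fun)

lemma strip_last_shift: "strip_last a (shift k v) = scale (q powi (k * sg a)) (shift k (strip_last a v))"
  by (simp add: shift_def strip_last_diag distrib_left q_powi_add diag_scale_fun mult.commute
      flip: diag_scale_fun)

text \<open>A nonzero multiple of the action of \<open>F\<^sub>0\<close> or \<open>F\<^sub>1\<close>; \<open>lam\<close> is the highest weight.\<close>

definition lower :: "letter \<Rightarrow> 'a VV \<Rightarrow> 'a VV"
  where "lower c v = scale (q powi (2 * lam c)) (shift (-2 * sg c) v \<star> gen c) - gen c \<star> v"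

lemma lin_lower: "lin (lower c)"
  unfolding lower_def by (intro lin_rules lin_comp[OF lin_star_left lin_shift])

lemma strip_first_lower:
  "strip_first a (lower c v) =
    scale (q powi (2 * lam c - 2 * sg a * sg c)) (shift (-2 * sg c) (strip_first a v) \<star> gen c)
    - scale (q powi (2 * sg a * sg c)) (gen c \<star> strip_first a v)
    + (if a = c then scale (q powi (2 * lam c) - 1) v else 0)"
  by (simp add: lower_def lin_diff[OF lin_strip_first] lin_scale[OF lin_strip_first]
      strip_first_letter_star strip_first_star_letter twist_shift shift_shift shift_0
      strip_first_shift free_alg.scale_right_distrib free_alg.scale_left_diff_distrib
      algebra_simps flip: q_powi_add)

text \<open>Up to normalisation this is the defining relation for [E_i, F_j]: the last term is a
  multiple of (K_i - K_i^-1) v.\<close>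

lemma strip_last_lower:
  "strip_last a (lower c v) = lower c (strip_last a v) +
    (if a = c then scale (q powi (2 * lam c)) (shift (-2 * sg c) v) - shift (2 * sg c) v else 0)"
  by (simp add: lower_def lin_diff[OF lin_strip_last] lin_scale[OF lin_strip_last]
      strip_last_letter_star strip_last_star_letter twist_shift
      strip_last_shift free_alg.scale_right_distrib algebra_simps flip: q_powi_add)

lemma homogeneous_lower: "homogeneous d v \<Longrightarrow> homogeneous (d(a := Suc (d a))) (lower a v)"
  unfolding lower_def shift_def
  by (intro homogeneous_diff homogeneous_scale homogeneous_star_letter homogeneous_letter_star
      homogeneous_diag)

section \<open>The Casimir identity\<close>

text \<open>
  Each lowering operator multiplies by a letter from the left or from the right, so a product of
  lowering operators expands into a sum over the deconcatenations \<open>x y\<close> of the \<open>q\<close>-shuffle product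
  of the letters, in which \<open>x\<close> acts from the right and is therefore reversed. This formula makes
  sense for every \<open>z\<close>, not only for \<open>z \<in> UU q\<close>.
\<close>

definition Phi_coeff :: "letter list \<Rightarrow> letter list \<Rightarrow> 'a"
  where "Phi_coeff x y = (-1) ^ length y *
    q powi (2 * wlam x - bal x * bal x + int (length x) - 2 * bal x * bal y)"

definition Phi_term :: "'a VV \<Rightarrow> letter list \<Rightarrow> letter list \<Rightarrow> 'a VV"
  where "Phi_term v x y =
    scale (Phi_coeff x y) (word y \<star> (shift (-2 * bal x) v \<star> word (rev x)))"

definition Phi :: "'a VV \<Rightarrow> 'a VV \<Rightarrow> 'a VV"
  where "Phi z v = lin_ext (\<lambda>w. spl w (Phi_term v)) z"

lemma lin_Phi_left: "lin (\<lambda>z. Phi z v)"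
  by (simp add: Phi_def)

lemma spl_linI:
  "(\<And>x y. lin (\<lambda>v. G v x y)) \<Longrightarrow> lin (\<lambda>v. spl w (G v))"
  by (induction w arbitrary: G) (simp_all add: lin_plus)

lemma lin_Phi_right: "lin (\<lambda>v. Phi z v)"
  unfolding Phi_def Phi_term_def
  by (intro lin_lin_ext_fun spl_linI lin_rules lin_shift)

text \<open>Deconcatenation is multiplicative for the braided product on the tensor square: the
  letter \<open>c\<close> either joins the left part, or passes \<open>x\<close> to join the right
  part, which costs the power of q.\<close>

lemma spl_letter_star:
  "lin_ext (\<lambda>z. spl z G) (gen c \<star> word w) =
    spl w (\<lambda>x y. lin_ext (\<lambda>x'. G x' y) (gen c \<star> word x) +
      scale (q powi (2 * bal x * sg c)) (lin_ext (G x) (gen c \<star> word y)))"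
proof (induction w arbitrary: G)
  case Nil
  show ?case by (simp add: add.commute)
next
  case (Cons b w)
  have gen_mult: "lin_ext H (gen b * v) = lin_ext (\<lambda>u. H (b # u)) v"
    for H :: "letter list \<Rightarrow> ('b, 'a) free_alg" and v
    by (rule lin_eqI) (intro lin_rules lin_lin_ext, simp_all)
  have plus: "lin_ext (\<lambda>u. H u + H' u) v = lin_ext H v + lin_ext H' v"
    for H H' :: "letter list \<Rightarrow> ('b, 'a) free_alg" and v
    by (simp add: lin_ext_def free_alg.scale_right_distrib sum.distrib)
  let ?k = "q powi (2 * sg c * sg b)"
  show ?case
    by (simp add: letter_star_Cons lin_add[OF lin_lin_ext] lin_scale[OF lin_lin_ext] gen_mult plus
        Cons spl_add lin_spl[OF lin_smult[OF lin_ident]] free_alg.scale_right_distrib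
        algebra_simps flip: q_powi_add)
qed

lemma keys_letter_star:
  assumes "u \<in> Poly_Mapping.keys (gen c \<star> word w)"
  shows "bal u = sg c + bal w" "wlam u = lam c + wlam w" "length u = Suc (length w)"
proof -
  have "count_list u = (count_list w)(c := Suc (count_list w c))"
    using homogeneous_letter_star[OF homogeneous_word] assms by (auto simp: homogeneous_def)
  then have "count_list u = count_list (c # w)"
    by (simp only: count_list_Cons_fun)
  then have "bal u = bal (c # w)" "wlam u = wlam (c # w)" "length u = length (c # w)"
    by (simp_all only: bal_count wlam_count length_count)
  then show "bal u = sg c + bal w" "wlam u = lam c + wlam w" "length u = Suc (length w)"
    by simp_all
qed

text \<open>Right multiplication in \<open>lower\<close> extends \<open>x\<close> and left
  multiplication extends \<open>y\<close>. The facts \<open>K\<close> and \<open>L\<close> check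
  that \<open>Phi_coeff\<close> is compatible with both.\<close>

lemma lower_Phi_term:
  "lower c (Phi_term v x y) = lin_ext (\<lambda>x'. Phi_term v x' y) (gen c \<star> word x) +
    scale (q powi (2 * bal x * sg c)) (lin_ext (Phi_term v x) (gen c \<star> word y))"
proof -
  let ?K = "(-1) ^ length y * q powi (2 * (lam c + wlam x) - (sg c + bal x) * (sg c + bal x)
    + int (Suc (length x)) - 2 * (sg c + bal x) * bal y)"
  let ?v = "shift (-2 * (sg c + bal x)) v"
  have "lin_ext (\<lambda>x'. Phi_term v x' y) (gen c \<star> word x) =
      lin_ext (\<lambda>x'. scale ?K (word y \<star> (?v \<star> reversal (word x')))) (gen c \<star> word x)"
    by (rule lin_ext_cong) (simp only: Phi_term_def Phi_coeff_def keys_letter_star reversal_word)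
  also have "\<dots> = scale ?K (word y \<star> (?v \<star> reversal (gen c \<star> word x)))"
    by (rule lin_eq_lin_ext[symmetric]) (intro lin_rules lin_reversal)
  also have "\<dots> = scale ?K (word y \<star> (?v \<star> (word (rev x) \<star> gen c)))"
    by (simp add: reversal_letter_star reversal_word)
  finally have 1: "lin_ext (\<lambda>x'. Phi_term v x' y) (gen c \<star> word x) =
    scale ?K (word y \<star> (?v \<star> (word (rev x) \<star> gen c)))" .
  let ?L = "(-1) ^ Suc (length y) * q powi (2 * wlam x - bal x * bal x + int (length x)
    - 2 * bal x * (sg c + bal y))"
  let ?w = "shift (-2 * bal x) v"
  have "lin_ext (Phi_term v x) (gen c \<star> word y) =
      lin_ext (\<lambda>y'. scale ?L (word y' \<star> (?w \<star> word (rev x)))) (gen c \<star> word y)"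
    by (rule lin_ext_cong) (simp only: Phi_term_def Phi_coeff_def keys_letter_star)
  also have "\<dots> = scale ?L ((gen c \<star> word y) \<star> (?w \<star> word (rev x)))"
    by (rule lin_eq_lin_ext[symmetric]) (intro lin_rules)
  finally have 2: "lin_ext (Phi_term v x) (gen c \<star> word y) =
    scale ?L (gen c \<star> (word y \<star> (?w \<star> word (rev x))))"
    by (simp add: star_assoc)
  have K: "q powi (2 * lam c) * (Phi_coeff x y * (q powi (-2 * sg c * bal y) * q powi (-2 * sg c * bal x))) = ?K"
    by (simp add: Phi_coeff_def algebra_simps flip: q_powi_add)
  have L: "- Phi_coeff x y = q powi (2 * bal x * sg c) * ?L"
    by (simp add: Phi_coeff_def algebra_simps flip: q_powi_add)
  have "lower c (Phi_term v x y) =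
      scale (q powi (2 * lam c) * (Phi_coeff x y * (q powi (-2 * sg c * bal y) * q powi (-2 * sg c * bal x))))
        (word y \<star> (?v \<star> (word (rev x) \<star> gen c)))
      + scale (- Phi_coeff x y) (gen c \<star> (word y \<star> (?w \<star> word (rev x))))"
    by (simp add: lower_def Phi_term_def lin_scale[OF lin_shift] shift_star shift_shift star_assoc
        distrib_left mult_ac)
  then show ?thesis
    unfolding 1 2 K L by simp
qed

text \<open>Together with \<open>Phi_Nil\<close> this identifies \<open>Phi\<close> of a product of
  letters with the composite of the corresponding lowering operators, so for z in
  \<open>UU q\<close> it is a polynomial in them.\<close>

lemma Phi_letter_star: "Phi (gen c \<star> z) v = lower c (Phi z v)"
proof (rule lin_eqI[where f = "\<lambda>z. Phi (gen c \<star> z) v"])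
  show "Phi (gen c \<star> word w) v = lower c (Phi (word w) v)" for w
    by (simp add: Phi_def spl_letter_star lin_spl[OF lin_lower] lower_Phi_term)
qed (intro lin_rules lin_comp[OF lin_Phi_left] lin_comp[OF lin_lower] lin_Phi_left)+

lemma Phi_Nil: "Phi (word []) v = v"
  by (simp add: Phi_def Phi_term_def Phi_coeff_def shift_0)

text \<open>The antipode of the braided Hopf algebra with this product and deconcatenation sends y
  to this multiple of \<open>rev y\<close>; the exponent is the sum of (y_i, y_j) over i <
  j.\<close>

definition antipode_coeff :: "letter list \<Rightarrow> 'a"
  where "antipode_coeff y = (-1) ^ length y * q powi (bal y * bal y - int (length y))"

lemma word_star_decomp:
  "word u \<star> word v = (if u = [] \<and> v = [] then word [] else 0)
    + (if u = [] then 0 else gen (hd u) * (word (tl u) \<star> word v))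
    + (if v = [] then 0 else
        scale (q powi (2 * bal u * sg (hd v))) (gen (hd v) * (word u \<star> word (tl v))))"
  by (cases u; cases v) (simp_all add: star_Cons)

text \<open>The leading letter of a product of x and \<open>rev y\<close> is the first or the last
  letter of w. Collecting terms accordingly gives the same sum for the tail \<open>t\<close> and for
  the initial part \<open>s\<close>. Both vanish by induction, except for a single letter, where
  they cancel.\<close>

lemma antipode_identity:
  "spl w (\<lambda>x y. scale (antipode_coeff y) (word x \<star> word (rev y))) =
    (if w = [] then word [] else 0)" (is "?A w = _")
proof (induction w rule: length_induct)
  case (1 w)
  show ?case
  proof (cases "w = []")
    case True
    then show ?thesis
      by (simp add: antipode_coeff_def)
  next
    case False
    then obtain a t where at: "w = a # t"
      by (cases w) auto
    obtain s c where sc: "w = s @ [c]"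
      using False by (cases w rule: rev_cases) auto
    have "?A w = spl w (\<lambda>x y. scale (antipode_coeff y)
        (if x = [] then 0 else gen (hd x) * (word (tl x) \<star> word (rev y))))
      + spl w (\<lambda>x y. scale (antipode_coeff y) (if y = [] then 0 else
        scale (q powi (2 * bal x * sg (last y))) (gen (last y) * (word x \<star> word (rev (butlast y))))))"
      unfolding spl_add[symmetric]
    proof (rule spl_cong)
      fix x y assume "x @ y = w"
      then show "scale (antipode_coeff y) (word x \<star> word (rev y)) =
          scale (antipode_coeff y)
            (if x = [] then 0 else gen (hd x) * (word (tl x) \<star> word (rev y)))
          + scale (antipode_coeff y) (if y = [] then 0 else
            scale (q powi (2 * bal x * sg (last y)))
              (gen (last y) * (word x \<star> word (rev (butlast y)))))"
        using False by (subst word_star_decomp)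
          (cases y rule: rev_cases; auto simp: free_alg.scale_right_distrib)
    qed
    also have "spl w (\<lambda>x y. scale (antipode_coeff y)
        (if x = [] then 0 else gen (hd x) * (word (tl x) \<star> word (rev y)))) = gen a * ?A t"
      unfolding at by (simp add: lin_spl[OF lin_mult_left] mult_scale_right)
    also have "spl w (\<lambda>x y. scale (antipode_coeff y) (if y = [] then 0 else
        scale (q powi (2 * bal x * sg (last y))) (gen (last y) * (word x \<star> word (rev (butlast y))))))
        = scale (- (q powi (2 * sg c * bal s))) (gen c * ?A s)"
    proof -
      have "antipode_coeff (y @ [c]) * q powi (2 * bal x * sg c) =
          - (q powi (2 * sg c * bal s) * antipode_coeff y)" if "x @ y = s" for x y
        by (simp add: antipode_coeff_def algebra_simps flip: that q_powi_add)
      then have "spl s (\<lambda>x y. scale (antipode_coeff (y @ [c]))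
          (scale (q powi (2 * bal x * sg c)) (gen c * (word x \<star> word (rev y))))) =
        spl s (\<lambda>x y. scale (- (q powi (2 * sg c * bal s)))
          (gen c * scale (antipode_coeff y) (word x \<star> word (rev y))))"
        by (intro spl_cong) (simp add: mult_scale_right)
      then show ?thesis
        unfolding sc spl_snoc
        by (simp only: lin_spl[OF lin_mult_left] lin_spl[OF lin_smult[OF lin_ident]]) simp
    qed
    also have "gen a * ?A t + scale (- (q powi (2 * sg c * bal s))) (gen c * ?A s) = 0"
    proof -
      have len: "length t < length w" "length s < length w" "t = [] \<longleftrightarrow> s = []" "t = [] \<Longrightarrow> a = c"
        using at sc by (auto simp: append_eq_Cons_conv)
      then show ?thesis
        using 1 by (cases "t = []") simp_all
    qed
    finally show ?thesis
      using False by simp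
  qed
qed

text \<open>It is multiplicative, so its diagonal map preserves \<open>UU q\<close>, and its powers
  of q are those that combine with \<open>Phi_coeff\<close> to
  \<open>antipode_coeff\<close>.\<close>

definition casimir_coeff :: "letter list \<Rightarrow> 'a"
  where "casimir_coeff y = (-1) ^ length y * q powi (-2 * wlam y - 2 * int (length y))"

text \<open>
  The Casimir element acts on the dual Verma module by a scalar: substituting the definition of
  \<open>Phi\<close> gives a sum over splittings of \<open>w\<close> into three parts, in which the antipode identity
  cancels everything except the term where only the third part is nonempty.
\<close>

lemma casimir_word:
  assumes "bal w = 0"
  shows "spl w (\<lambda>x y. scale (casimir_coeff y) (Phi (word y) (word x))) =
    scale (q powi (-2 * wlam w - 2 * int (length w))) (word w)"
proof -
  have *: "casimir_coeff (y @ z) * (Phi_coeff y z * q powi (-2 * bal y * bal x)) =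
      q powi (-2 * wlam z - 2 * int (length z)) * antipode_coeff y" if "(x @ y) @ z = w" for x y z
  proof -
    \<comment> \<open>Balance zero enters here: it reverses the sign of \<open>bal y * bal y\<close>
      in the exponent and cancels the mixed term in y and z.\<close>
    have "bal x = - bal y - bal z"
      using assms that by auto
    have "bal y * bal x = bal y * (- bal y - bal z)"
      by (simp only: \<open>bal x = - bal y - bal z\<close>)
    then have exponent: "(-2 * wlam (y @ z) - 2 * int (length (y @ z))) +
        ((2 * wlam y - bal y * bal y + int (length y) - 2 * bal y * bal z) + (-2 * bal y * bal x)) =
        (-2 * wlam z - 2 * int (length z)) + (bal y * bal y - int (length y))"
      by (simp add: algebra_simps)
    have sign: "(-1) ^ length (y @ z) * (-1) ^ length z = ((-1) ^ length y :: 'a)"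
      by (simp add: power_add mult.assoc flip: power_mult_distrib)
    show ?thesis
      unfolding casimir_coeff_def Phi_coeff_def antipode_coeff_def sign[symmetric]
      using arg_cong[OF exponent, of "(powi) q"] by (simp only: q_powi_add mult_ac)
  qed
  have "spl w (\<lambda>x y. scale (casimir_coeff y) (Phi (word y) (word x))) =
      spl w (\<lambda>x v. spl v (\<lambda>y z. scale (casimir_coeff (y @ z)) (Phi_term (word x) y z)))"
    by (simp add: Phi_def lin_spl[OF lin_smult[OF lin_ident]] cong: spl_cong)
  also have "\<dots> = spl w (\<lambda>u z. spl u (\<lambda>x y. scale (casimir_coeff (y @ z)) (Phi_term (word x) y z)))"
    by (rule spl_coassoc)
  also have "\<dots> = spl w (\<lambda>u z. spl u (\<lambda>x y. scale (q powi (-2 * wlam z - 2 * int (length z)))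
      (word z \<star> scale (antipode_coeff y) (word x \<star> word (rev y)))))"
  proof (intro spl_cong)
    fix u z x y assume "u @ z = w" "x @ y = u"
    then have "(x @ y) @ z = w" by simp
    have "scale (casimir_coeff (y @ z)) (Phi_term (word x) y z) =
        scale (casimir_coeff (y @ z) * (Phi_coeff y z * q powi (-2 * bal y * bal x)))
          (word z \<star> (word x \<star> word (rev y)))"
      by (simp add: Phi_term_def)
    also have "\<dots> = scale (q powi (-2 * wlam z - 2 * int (length z)))
        (word z \<star> scale (antipode_coeff y) (word x \<star> word (rev y)))"
      unfolding *[OF \<open>(x @ y) @ z = w\<close>] by simp
    finally show "scale (casimir_coeff (y @ z)) (Phi_term (word x) y z) =
        scale (q powi (-2 * wlam z - 2 * int (length z)))
          (word z \<star> scale (antipode_coeff y) (word x \<star> word (rev y)))" .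
  qed
  also have "\<dots> = spl w (\<lambda>u z. if u = [] then scale (q powi (-2 * wlam z - 2 * int (length z))) (word z) else 0)"
    unfolding lin_spl[OF lin_smult[OF lin_star_right], symmetric] antipode_identity
    by (intro spl_cong) simp
  finally show ?thesis
    by (simp add: spl_Nil_left)
qed

end

lemma spl_Nil_right: "spl w (\<lambda>u v. if v = [] then G u else 0) = G w"
  by (induction w arbitrary: G) simp_all

lemma V_bold_iff:
  "v \<in> V_bold \<longleftrightarrow> strip_first Ly v = 0 \<and> strip_first Lx (strip_first Lx v) = 0"
  by (simp add: V_bold_def numeral_2_eq_2)

context quantum
begin

section \<open>The module \<open>UU\<close> and its intersection with \<open>V_bold\<close>\<close>

lemma diag_in_UU:
  assumes "v \<in> UU q" "f [] = 1" "\<And>u w. f (u @ w) = f u * f w"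
  shows "diag f v \<in> UU q"
  using assms(1)
proof (rule UU_induct)
  show "diag f (gen a \<star> v) \<in> UU q" if "diag f v \<in> UU q" for a v
    using that by (simp add: diag_star[of f] assms(2,3) star_in_UU gen_in_UU
        free_alg.subspace_scale[OF subspace_UU])
qed (simp_all add: subspace_vimage lin_diag subspace_UU assms(2) Nil_in_UU)

lemma shift_in_UU: "v \<in> UU q \<Longrightarrow> shift k v \<in> UU q"
  unfolding shift_def by (rule diag_in_UU) (simp_all add: distrib_left q_powi_add)

lemma strip_last_in_UU:
  assumes "v \<in> UU q"
  shows "strip_last a v \<in> UU q"
  using assms
proof (rule UU_induct)
  show "strip_last a (word []) \<in> UU q"
    by (simp add: strip_last_word free_alg.subspace_0[OF subspace_UU])
  show "strip_last a (gen c \<star> v) \<in> UU q" if "v \<in> UU q" "strip_last a v \<in> UU q" for c v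
    using that by (auto simp: strip_last_letter_star twist_shift intro!: star_in_UU gen_in_UU
        shift_in_UU free_alg.subspace_add[OF subspace_UU])
qed (rule subspace_vimage[OF lin_strip_last subspace_UU])

lemma lower_in_UU: "v \<in> UU q \<Longrightarrow> lower a v \<in> UU q"
  unfolding lower_def
  by (intro free_alg.subspace_diff free_alg.subspace_scale subspace_UU star_in_UU gen_in_UU shift_in_UU)

lemma subspace_V_bold: "free_alg.subspace (V_bold :: 'a VV set)"
  by (auto simp: free_alg.subspace_def V_bold_iff lin_0 lin_add lin_scale lin_strip_first)

lemma Nil_in_V_bold: "word [] \<in> V_bold"
  by (simp add: V_bold_iff strip_first_word lin_0 lin_strip_first)

lemma diag_in_V_bold: "v \<in> V_bold \<Longrightarrow> diag f v \<in> V_bold"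
  by (simp add: V_bold_iff strip_first_diag lin_0 lin_diag)

lemma strip_last_in_V_bold: "v \<in> V_bold \<Longrightarrow> strip_last a v \<in> V_bold"
  by (simp add: V_bold_iff strip_first_strip_last lin_0 lin_strip_last)

text \<open>The extra term of \<open>strip_first_lower\<close> vanishes for y since
  \<open>lam Ly = 0\<close>. For x, a second strip leaves the multiples 1, -q^2 and q^2 - 1 of
  \<open>strip_first Lx v\<close>, whose sum is zero.\<close>

lemma lower_in_V_bold:
  assumes "v \<in> V_bold"
  shows "lower a v \<in> V_bold"
proof -
  note 0 = lin_0[OF lin_strip_first] lin_0[OF lin_shift]
  have Ly: "strip_first Ly v = 0" and Lx: "strip_first Lx (strip_first Lx v) = 0"
    using assms by (simp_all add: V_bold_iff)
  have "strip_first Ly (lower a v) = 0"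
    using Ly by (cases a) (simp_all add: strip_first_lower 0)
  moreover have "strip_first Lx (strip_first Lx (lower a v)) = 0"
  proof (cases a)
    case a: Lx
    have "q powi 2 * q powi -2 = 1"
      unfolding q_powi_add[symmetric] by simp
    then show ?thesis
      using Lx unfolding a strip_first_lower
      by (simp add: 0 lin_add[OF lin_strip_first] lin_diff[OF lin_strip_first]
          lin_scale[OF lin_strip_first] strip_first_star_letter strip_first_letter_star
          strip_first_shift twist_shift shift_shift shift_0 free_alg.scale_left_diff_distrib)
  next
    case a: Ly
    show ?thesis
      using Lx unfolding a strip_first_lower
      by (simp add: 0 lin_add[OF lin_strip_first] lin_diff[OF lin_strip_first]
          lin_scale[OF lin_strip_first] strip_first_star_letter strip_first_letter_star
          strip_first_shift twist_shift)
  qed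
  ultimately show ?thesis
    by (simp add: V_bold_iff)
qed

text \<open>The two conditions defining \<open>V_bold\<close> give nilpotency index 1 for y and 2
  for x in the degree bound.\<close>

lemma V_bold_degree:
  assumes "v \<in> UU q" "v \<in> V_bold" "homogeneous d v"
    and "2 * d Lx < d Ly \<or> 2 * d Ly + 1 < d Lx"
  shows "v = 0"
  using assms(4)
proof
  assume "2 * d Lx < d Ly"
  then show ?thesis
    using assms by (intro strip_first_nilpotent_degree[of v Lx Ly d 1]) (auto simp: V_bold_iff)
next
  assume "2 * d Ly + 1 < d Lx"
  then show ?thesis
    using assms by (intro strip_first_nilpotent_degree[of v Ly Lx d 2])
      (auto simp: V_bold_iff numeral_2_eq_2)
qed

lemma shift_homogeneous:
  "homogeneous d v \<Longrightarrow> shift k v = scale (q powi (k * (int (d Lx) - int (d Ly)))) v"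
  unfolding shift_def by (erule diag_homogeneous) (auto simp: bal_count)

end

section \<open>Stable subspaces when q is not a root of unity\<close>

locale quantum_generic = quantum q for q :: "'a::field" +
  assumes not_root_of_unity: "0 < n \<Longrightarrow> q ^ n \<noteq> 1"
begin

lemma q_powi_neq_1: "k \<noteq> 0 \<Longrightarrow> q powi k \<noteq> 1"
  using not_root_of_unity[of "nat k"] not_root_of_unity[of "nat (- k)"]
  by (cases "k > 0") (auto simp: power_int_def power_inverse)

lemma q_powi_diff_neq_0: "k \<noteq> 0 \<Longrightarrow> q powi k - q powi (- k) \<noteq> 0"
  using q_powi_neq_1[of "k + k"] unfolding q_powi_add by (auto simp: power_int_minus field_simps)

text \<open>The q-analogue of summing an arithmetic progression. For t = 1 and n > 0 both factors on
  the right are nonzero, which makes the constants \<open>C k\<close> of the next proof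
  nonzero.\<close>

lemma sl2_sum:
  "(\<Sum>j\<le>k. q powi (- (n + 2 * t * int j)) - q powi (n + 2 * t * int j)) * (q powi t - q powi (- t)) =
    (q powi (- (t * int k + t)) - q powi (t * int k + t)) *
    (q powi (n + t * int k) - q powi (- (n + t * int k)))"
  by (induction k) (simp_all add: algebra_simps flip: q_powi_add)

text \<open>Write E and F for \<open>strip_last c\<close> and \<open>lower c\<close>; by
  \<open>neg\<close> the weight -n of v at the node of \<open>c\<close> is negative. Since E v lies
  in \<open>U\<close>, the vector E F^(k+1) v is modulo \<open>U\<close> the nonzero multiple
  \<open>C k\<close> of F^k v. As F^k v vanishes for large k, membership in \<open>U\<close>
  descends step by step to v.\<close>

lemma lower_sl2:
  assumes U: "free_alg.subspace U" "\<And>a u. u \<in> U \<Longrightarrow> lower a u \<in> U"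
    "\<And>a u. u \<in> U \<Longrightarrow> strip_last a u \<in> U"
    and v: "v \<in> UU q" "v \<in> V_bold" "homogeneous d v" "strip_last c v \<in> U"
    and neg: "lam c < 2 * (sg c * (int (d Lx) - int (d Ly)))"
  shows "v \<in> U"
proof -
  define n where "n = 2 * (sg c * (int (d Lx) - int (d Ly))) - lam c"
  define D where "D j = q powi (- (n + 2 * int j)) - q powi (n + 2 * int j)" for j
  define C where "C k = q powi lam c * (\<Sum>j\<le>k. D j)" for k
  let ?f = "\<lambda>k. (lower c ^^ k) v"
  have f_hom: "homogeneous (d(c := d c + k)) (?f k)" for k
  proof (induction k)
    case (Suc k)
    have "d(c := d c + Suc k) = (d(c := d c + k))(c := Suc ((d(c := d c + k)) c))"
      by simp
    then show ?case
      using homogeneous_lower[OF Suc, of c] by (simp only: funpow.simps o_apply)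
  qed (simp add: v)
  have f_UU: "?f k \<in> UU q" "?f k \<in> V_bold" for k
    by (induction k) (simp_all add: v lower_in_UU lower_in_V_bold)
  have step: "strip_last c (lower c (?f k)) = lower c (strip_last c (?f k)) +
      scale (q powi lam c * D k) (?f k)" for k
  proof -
    have bal: "sg c * (int ((d(c := d c + k)) Lx) - int ((d(c := d c + k)) Ly)) =
        sg c * (int (d Lx) - int (d Ly)) + int k"
      by (cases c) simp_all
    have shifts: "shift (2 * sg c) (?f k) = scale (q powi (n + lam c + 2 * int k)) (?f k)"
      "shift (-2 * sg c) (?f k) = scale (q powi (- (n + lam c + 2 * int k))) (?f k)"
      unfolding shift_homogeneous[OF f_hom]
      using bal by (simp_all add: n_def mult.assoc)
    show ?thesis
      unfolding strip_last_lower shifts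
      by (simp add: D_def algebra_simps flip: q_powi_add)
  qed
  have E: "strip_last c (?f (Suc k)) - scale (C k) (?f k) \<in> U" for k
  proof (induction k)
    case 0
    show ?case
      using step[of 0] U v by (simp add: C_def)
  next
    case (Suc k)
    have "strip_last c (?f (Suc (Suc k))) - scale (C (Suc k)) (?f (Suc k)) =
        lower c (strip_last c (?f (Suc k)) - scale (C k) (?f k))"
      using step[of "Suc k"]
      by (simp add: lin_diff[OF lin_lower] lin_scale[OF lin_lower] C_def distrib_left
          free_alg.scale_left_distrib)
    then show ?case
      using U Suc by simp
  qed
  have C: "C k \<noteq> 0" for k
  proof -
    have "(\<Sum>j\<le>k. D j) * (q powi 1 - q powi (- 1)) \<noteq> 0"
      unfolding D_def using sl2_sum[of n 1 k]
      using q_powi_diff_neq_0[of "int k + 1"] q_powi_diff_neq_0[of "n + int k"] neg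
      by (auto simp: n_def)
    then show ?thesis
      by (auto simp: C_def)
  qed
  have down: "?f k \<in> U" if "?f (Suc k) \<in> U" for k
  proof -
    have "scale (C k) (?f k) \<in> U"
      using free_alg.subspace_diff[OF U(1) U(3)[OF that, of c] E[of k]] by simp
    then have "scale (inverse (C k)) (scale (C k) (?f k)) \<in> U"
      by (rule free_alg.subspace_scale[OF U(1)])
    then show ?thesis
      using C by simp
  qed
  \<comment> \<open>Adding this many letters \<open>c\<close> to \<open>d\<close> leaves the range
    of degrees allowed by \<open>V_bold_degree\<close>, whichever letter \<open>c\<close>
    is.\<close>
  let ?K = "2 + 2 * (d Lx + d Ly)"
  have "?f ?K = 0"
    by (rule V_bold_degree[OF f_UU f_hom]) (cases c; simp)
  then have "?f ?K \<in> U"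
    by (simp only: free_alg.subspace_0[OF U(1)])
  moreover have "?f 0 \<in> U" if "?f k \<in> U" for k
    using that by (induction k) (use down in auto)
  ultimately have "?f 0 \<in> U"
    by blast
  then show ?thesis by simp
qed

lemma casimir_in_subspace:
  assumes U: "free_alg.subspace U" "\<And>a u. u \<in> U \<Longrightarrow> lower a u \<in> U"
    "\<And>a u. u \<in> U \<Longrightarrow> strip_last a u \<in> U"
    and v: "v \<in> UU q" "homogeneous d v" "\<And>a. strip_last a v \<in> U"
    and d: "d Lx = d Ly" "0 < d Ly"
  shows "v \<in> U"
proof -
  \<comment> \<open>A word of degree \<open>d\<close> has \<open>wlam\<close> equal to
    \<open>d Ly\<close> and length twice that, so the exponent in \<open>casimir_word\<close> is (-2
    - 4) times \<open>d Ly\<close>.\<close>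
  define k where "k = q powi (-6 * int (d Ly))"
  let ?G = "\<lambda>x y. scale (casimir_coeff y) (Phi (word y) (word x))"
  let ?\<Theta> = "\<lambda>z u. Phi (diag casimir_coeff z) u"
  let ?R = "lin_ext (\<lambda>w. spl w (\<lambda>x y. if y = [] then 0 else ?\<Theta> (word y) (word x))) v"
  have Phi_in_U: "Phi z u \<in> U" if "z \<in> UU q" "u \<in> U" for z u
    using that(1) by (rule UU_induct)
      (simp_all add: subspace_vimage lin_Phi_left U Phi_Nil Phi_letter_star that)
  have "?R \<in> U"
  proof (rule spl_in_subspace[where \<Theta> = ?\<Theta> and U = U and Z = "UU q"])
    show "?\<Theta> z u \<in> U" if "z \<in> UU q" "u \<in> U" for z u
    proof (intro Phi_in_U diag_in_UU)
      fix x y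
      have "-2 * wlam (x @ y) - 2 * int (length (x @ y)) =
          (-2 * wlam x - 2 * int (length x)) + (-2 * wlam y - 2 * int (length y))"
        by simp
      then show "casimir_coeff (x @ y) = casimir_coeff x * casimir_coeff y"
        unfolding casimir_coeff_def by (simp only: q_powi_add length_append power_add mult_ac)
    qed (use that in \<open>simp_all add: casimir_coeff_def\<close>)
  qed (use U v in \<open>auto intro: lin_comp[OF lin_Phi_left lin_diag] lin_Phi_right subspace_UU
      Nil_in_UU strip_first_in_UU\<close>)
  have "spl w (\<lambda>x y. if y = [] then 0 else ?\<Theta> (word y) (word x)) = scale (k - 1) (word w)"
    if "w \<in> Poly_Mapping.keys v" for w
  proof -
    have w: "count_list w = d"
      using that v(2) by (simp add: homogeneous_def)
    \<comment> \<open>The splitting with empty y contributes \<open>word w\<close> itself; moving it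
      to the other side leaves the factor \<open>k - 1\<close>.\<close>
    have "spl w ?G = spl w (\<lambda>x y. if y = [] then 0 else ?\<Theta> (word y) (word x)) + word w"
    proof -
      have "spl w ?G = spl w (\<lambda>x y. (if y = [] then 0 else ?\<Theta> (word y) (word x)) +
          (if y = [] then word x else 0))"
        by (rule spl_cong) (auto simp: casimir_coeff_def Phi_Nil lin_scale[OF lin_Phi_left])
      then show ?thesis
        by (simp add: spl_add spl_Nil_right)
    qed
    moreover have "spl w ?G = scale k (word w)"
      using casimir_word[of w] d by (simp add: w bal_count wlam_count length_count k_def)
    ultimately show ?thesis
      by (simp add: free_alg.scale_left_diff_distrib eq_diff_eq)
  qed
  then have "?R = lin_ext (\<lambda>w. scale (k - 1) (word w)) v"
    by (rule lin_ext_cong)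
  also have "\<dots> = scale (k - 1) v"
    by (rule lin_eq_lin_ext[symmetric]) (intro lin_rules)
  finally have "scale (inverse (k - 1)) (scale (k - 1) v) \<in> U"
    using \<open>?R \<in> U\<close> U by (simp only: free_alg.subspace_scale)
  moreover have "k \<noteq> 1"
    unfolding k_def using d by (intro q_powi_neq_1) simp
  ultimately show ?thesis
    by simp
qed

lemma UU_Int_V_bold_subset:
  assumes U: "free_alg.subspace U" "\<And>a u. u \<in> U \<Longrightarrow> lower a u \<in> U"
    "\<And>a u. u \<in> U \<Longrightarrow> strip_last a u \<in> U" and Nil: "word [] \<in> U"
  shows "UU q \<inter> V_bold \<subseteq> U"
proof -
  have hom: "v \<in> U" if "v \<in> UU q" "v \<in> V_bold" "homogeneous d v" for v d
    using that
  proof (induction "d Lx + d Ly" arbitrary: v d rule: less_induct)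
    case less
    have E: "strip_last a v \<in> U" for a
    proof (cases "d a = 0")
      case True
      then show ?thesis
        using strip_last_homogeneous_0[OF less.prems(3)] U by (simp add: free_alg.subspace_0)
    next
      case False
      let ?d = "d(a := d a - 1)"
      show ?thesis
      proof (rule less.hyps)
        show "?d Lx + ?d Ly < d Lx + d Ly"
          using False by (cases a) auto
        show "homogeneous ?d (strip_last a v)"
          using False less.prems by (intro homogeneous_strip_last) simp
      qed (use less.prems strip_last_in_UU strip_last_in_V_bold in auto)
    qed
    \<comment> \<open>With more y than x the weight at node 1 is negative; with more x than y the
      weight at node 0, which is 1 - 2 (d Lx - d Ly), is negative.\<close>
    consider "d Lx < d Ly" | "d Ly < d Lx" | "d Lx = d Ly" "0 < d Ly" | "d Lx = 0" "d Ly = 0"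
      by linarith
    then show ?case
    proof cases
      case 1
      then show ?thesis
        by (intro lower_sl2[OF U less.prems E[of Ly]]) simp_all
    next
      case 2
      then show ?thesis
        by (intro lower_sl2[OF U less.prems E[of Lx]]) simp_all
    next
      case 3
      then show ?thesis
        by (intro casimir_in_subspace[OF U less.prems(1,3) E]) simp_all
    next
      case 4
      have "v = scale (Poly_Mapping.lookup v []) (word [])"
      proof (rule poly_mapping_eqI)
        fix w
        have "count_list w \<noteq> d" if "w \<noteq> []"
          using that 4 length_count[of w] by auto
        then show "Poly_Mapping.lookup v w =
            Poly_Mapping.lookup (scale (Poly_Mapping.lookup v []) (word [])) w"
          using less.prems(3) by (auto simp: homogeneous_iff lookup_word when_def)
      qed
      then show ?thesis
        using free_alg.subspace_scale[OF U(1) Nil] by (rule ssubst)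
    qed
  qed
  show ?thesis
  proof
    fix v assume v: "v \<in> UU q \<inter> V_bold"
    \<comment> \<open>Both \<open>UU q\<close> and \<open>V_bold\<close> are graded, so it suffices
      to treat homogeneous components.\<close>
    have "component d v \<in> U" for d
    proof (rule hom)
      show "component d v \<in> V_bold"
        unfolding component_def using v by (intro diag_in_V_bold) simp
    qed (use v in \<open>auto intro: component_in_UU homogeneous_component\<close>)
    then have "(\<Sum>d\<in>count_list ` Poly_Mapping.keys v. component d v) \<in> U"
      by (intro free_alg.subspace_sum U(1))
    then show "v \<in> U"
      by (simp add: sum_component)
  qed
qed

end

section \<open>Submodules in terms of the generators\<close>

lemma ring_free_ring: "ring (free_ring :: ('g, 'a::field) free_alg ring)"
proof (rule ringI)
  show "abelian_group (free_ring :: ('g, 'a) free_alg ring)"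
  proof (rule abelian_groupI)
    fix x :: "('g, 'a) free_alg"
    show "\<exists>y\<in>carrier free_ring. y \<oplus>\<^bsub>free_ring\<^esub> x = \<zero>\<^bsub>free_ring\<^esub>"
      by (auto simp: free_ring_def intro: exI[of _ "- x"])
  qed (auto simp: free_ring_def algebra_simps)
  show "Group.monoid (free_ring :: ('g, 'a) free_alg ring)"
    by (rule Group.monoidI) (auto simp: free_ring_def mult.assoc)
qed (auto simp: free_ring_def algebra_simps)

lemma ideal_Uq_ideal: "ideal (Uq_ideal q) free_ring"
  unfolding Uq_ideal_def by (rule ring.genideal_ideal[OF ring_free_ring]) (simp add: free_ring_def)

lemma carrier_Uq: "carrier (Uq q) = range (Uq_class q)"
  by (auto simp: Uq_def FactRing_def A_RCOSETS_def' Uq_class_def free_ring_def)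

lemma Uq_class_mult: "Uq_class q (a * b) = Uq_class q a \<otimes>\<^bsub>Uq q\<^esub> Uq_class q b"
  using ideal.rcoset_mult_add[OF ideal_Uq_ideal, of a b]
  by (simp add: Uq_class_def Uq_def FactRing_def free_ring_def)

lemma Uq_class_add: "Uq_class q (a + b) = Uq_class q a \<oplus>\<^bsub>Uq q\<^esub> Uq_class q b"
  using abelian_subgroup.a_rcos_sum[OF abelian_subgroupI3[OF
      ideal.axioms(1)[OF ideal_Uq_ideal] ring.is_abelian_group[OF ring_free_ring]], of a b]
  by (simp add: Uq_class_def Uq_def FactRing_def free_ring_def)

lemma Uq_class_one: "Uq_class q 1 = \<one>\<^bsub>Uq q\<^esub>"
  by (simp add: Uq_class_def Uq_def FactRing_def free_ring_def)

text \<open>For fixed v, the elements of the free algebra whose class sends v into \<open>S\<close>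
  form a subspace; it contains every word by induction on the word, hence everything.\<close>

lemma Uq_submoduleI:
  assumes act: "UU_action q act" and S: "free_alg.subspace S" "S \<subseteq> UU q"
    and gens: "\<And>g v. v \<in> S \<Longrightarrow> gen_map q g v \<in> S"
  shows "Uq_submodule q act (UU q) S"
proof -
  have mult: "act (Uq_class q (a * b)) v = act (Uq_class q a) (act (Uq_class q b) v)"
    and add: "act (Uq_class q (a + b)) v = act (Uq_class q a) v + act (Uq_class q b) v"
    and scale: "act (Uq_class q (scale c a)) v = scale c (act (Uq_class q a) v)"
    and one: "act (Uq_class q 1) v = v"
    and gen: "act (Uq_class q (gen g)) v = gen_map q g v"
    if "v \<in> UU q" for a b c g v
    using act that unfolding UU_action_def Uq_module_def carrier_Uq
    by (simp_all add: Uq_class_mult Uq_class_add Uq_class_one)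
  have word: "act (Uq_class q (word w)) v \<in> S" if "v \<in> S" for w v
  proof (induction w)
    case Nil
    then show ?case
      using that S one[of v] by (auto simp: word_Nil)
  next
    case (Cons g w)
    have "act (Uq_class q (gen g * word w)) v \<in> S"
      using that S Cons by (subst mult) (auto simp: gen subset_iff gens)
    then show ?case by simp
  qed
  have "act (Uq_class q p) v \<in> S" if "v \<in> S" for p v
  proof -
    have v: "v \<in> UU q"
      using that S by auto
    have "free_alg.subspace {p. act (Uq_class q p) v \<in> S}"
      unfolding free_alg.subspace_def
      \<comment> \<open>The instance of \<open>scale\<close> at zero shows that the class of 0 acts
        as zero.\<close>
      using S(1) scale[OF v, of 0 0] by (auto simp: add[OF v] scale[OF v] free_alg.subspace_0
          free_alg.subspace_add free_alg.subspace_scale)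
    then have "lin_ext word p \<in> {p. act (Uq_class q p) v \<in> S}"
      by (rule lin_ext_in_subspace) (use word that in auto)
    then show ?thesis by simp
  qed
  then show ?thesis
    using S by (auto simp: Uq_submodule_def carrier_Uq)
qed

lemma gen_map_in_submodule:
  assumes "UU_action q act" "Uq_submodule q act (UU q) S" "v \<in> S"
  shows "gen_map q g v \<in> S"
proof -
  have "act (Uq_class q (gen g)) v \<in> S"
    using assms by (auto simp: Uq_submodule_def carrier_Uq)
  moreover have "v \<in> UU q"
    using assms by (auto simp: Uq_submodule_def)
  ultimately show ?thesis
    using assms(1) by (simp add: UU_action_def)
qed

text \<open>The hull is an intersection of submodules; that \<open>W\<close> is one of them keeps it
  inside \<open>W\<close>.\<close>

lemma Uq_submodule_hull:
  assumes "Uq_submodule q act W W" "A \<subseteq> W"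
  shows "Uq_submodule q act W (Uq_submodule q act W hull A)"
proof -
  have "(Uq_submodule q act W hull A) \<subseteq> W"
    using assms by (intro hull_minimal)
  moreover have "free_alg.subspace (Uq_submodule q act W hull A)"
    unfolding hull_def by (rule free_alg.subspace_Inter) (auto simp: Uq_submodule_def)
  ultimately show ?thesis
    by (auto simp: Uq_submodule_def hull_def)
qed

section \<open>The generators in terms of \<open>diag\<close>, \<open>strip_last\<close> and
  \<open>lower\<close>\<close>

context quantum
begin

lemma alg_hom_scale:
  fixes c :: "letter \<Rightarrow> 'a"
  assumes "f [] = 1" "\<And>a w. f (a # w) = c a * f w"
  shows "alg_hom (\<lambda>a. scale (c a) (gen a)) v = diag f v"
proof -
  have "prod_list (map (\<lambda>a. scale (c a) (gen a)) w) = scale (f w) (word w)" for w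
    by (induction w) (simp_all add: assms word_Nil mult_scale_left mult_scale_right)
  then show ?thesis
    by (simp add: alg_hom_def diag_def)
qed

lemma K_map: "K_map q = shift 2"
proof -
  have "(\<lambda>a. case a of Lx \<Rightarrow> scale (q powi 2) (gen Lx) | Ly \<Rightarrow> scale (q powi -2) (gen Ly)) =
      (\<lambda>a. scale (q powi (2 * sg a)) (gen a))"
    by (auto simp: fun_eq_iff split: letter.split)
  then show ?thesis
    unfolding K_map_def shift_def by (intro ext) (simp only:, rule alg_hom_scale,
        simp_all add: distrib_left q_powi_add)
qed

lemma X_map: "X_map q = diag (\<lambda>w. q ^ count_list w Lx)"
proof -
  have "(\<lambda>a. case a of Lx \<Rightarrow> scale q (gen Lx) | Ly \<Rightarrow> gen Ly) =
      (\<lambda>a. scale (if a = Lx then q else 1) (gen a))"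
    by (auto simp: fun_eq_iff split: letter.split)
  then show ?thesis
    unfolding X_map_def by (intro ext) (simp only:, rule alg_hom_scale, simp_all)
qed

lemma inv_diag:
  assumes "\<And>w. f w \<noteq> 0"
  shows "inv_into UNIV (diag f) v = diag (\<lambda>w. inverse (f w)) v"
proof (rule inv_into_f_eq)
  show "inj (diag f)"
    by (rule inj_on_inverseI[of _ "diag (\<lambda>w. inverse (f w))"])
      (simp add: diag_diag assms diag_one)
qed (simp_all add: diag_diag assms diag_one)

lemma K_inv: "K_inv q v = shift (-2) v"
  unfolding K_map shift_def by (subst inv_diag) (simp_all add: power_int_minus)

lemma X_inv: "X_inv q v = diag (\<lambda>w. inverse (q ^ count_list w Lx)) v"
  unfolding X_map by (rule inv_diag) simp

text \<open>In \<open>lower\<close> the left multiplication has coefficient -1, which accounts for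
  the additional factor \<open>inverse q\<close> at node 0.\<close>

lemma gen_map_F:
  "gen_map q (F_gen N0) v = scale (inverse (q - inverse q) * inverse q) (lower Lx v)"
  "gen_map q (F_gen N1) v = scale (inverse (q - inverse q)) (lower Ly v)"
proof -
  have "inverse q * q powi 2 = q"
    by (simp add: power2_eq_square)
  then show "gen_map q (F_gen N0) v = scale (inverse (q - inverse q) * inverse q) (lower Lx v)"
    by (simp add: A_r_def A_l_def K_inv lower_def star_def free_alg.scale_right_diff_distrib mult.assoc)
  show "gen_map q (F_gen N1) v = scale (inverse (q - inverse q)) (lower Ly v)"
    by (simp add: B_r_def B_l_def K_map lower_def star_def)
qed

lemma gen_map_in_UU_Int_V_bold:
  assumes "v \<in> UU q \<inter> V_bold"
  shows "gen_map q g v \<in> UU q \<inter> V_bold"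
proof -
  let ?N = "UU q \<inter> V_bold"
  have sub: "free_alg.subspace ?N"
    by (intro free_alg.subspace_inter subspace_UU subspace_V_bold)
  have strip: "strip_last a v \<in> ?N" and lower: "lower a v \<in> ?N" for a
    using assms strip_last_in_UU strip_last_in_V_bold lower_in_UU lower_in_V_bold by auto
  have diag: "diag f v \<in> ?N" if "f [] = 1" "\<And>u w. f (u @ w) = f u * f w" for f
    using assms that diag_in_UU diag_in_V_bold by auto
  have shift: "shift k v \<in> ?N" for k
    using assms shift_in_UU diag_in_V_bold by (auto simp: shift_def)
  note scale = free_alg.subspace_scale[OF sub]
  show ?thesis
  proof (cases g)
    case (K_gen i)
    then show ?thesis
      by (cases i) (simp_all only: gen_map.simps K_inv, simp_all only: K_map scale shift)
  next
    case (Kinv_gen i)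
    then show ?thesis
      by (cases i) (simp_all only: gen_map.simps K_inv, simp_all only: K_map scale shift)
  next
    case D_gen
    then show ?thesis
      by (simp only: gen_map.simps X_inv) (rule diag, simp_all add: power_add)
  next
    case Dinv_gen
    then show ?thesis
      by (simp only: gen_map.simps X_map) (rule diag, simp_all add: power_add)
  next
    case (E_gen i)
    then show ?thesis
      by (cases i) (simp_all only: gen_map.simps strip)
  next
    case (F_gen i)
    then show ?thesis
      by (cases i) (simp_all only: gen_map_F scale lower)
  qed
qed

end

theorem theorem11p11:
  fixes q :: "'a::field_char_0"
    and act :: "(uq_gen, 'a) free_alg set \<Rightarrow> 'a VV \<Rightarrow> 'a VV"
  assumes "q \<noteq> 0"
    and "\<forall>n>0. q ^ n \<noteq> 1"
    and "UU_action q act"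
  shows "Uq_submodule q act (UU q) hull {word []} = UU q \<inter> V_bold"
proof
  interpret quantum_generic q
    using assms by unfold_locales auto
  let ?U = "Uq_submodule q act (UU q) hull {word []}"
  have "Uq_submodule q act (UU q) (UU q \<inter> V_bold)"
    by (intro Uq_submoduleI assms(3) free_alg.subspace_inter subspace_UU subspace_V_bold
        gen_map_in_UU_Int_V_bold) auto
  then show "?U \<subseteq> UU q \<inter> V_bold"
    using Nil_in_UU Nil_in_V_bold by (intro hull_minimal) auto
  have "Uq_submodule q act (UU q) (UU q)"
    using assms(3) by (auto simp: UU_action_def Uq_module_def Uq_submodule_def)
  then have U: "Uq_submodule q act (UU q) ?U"
    using Nil_in_UU by (intro Uq_submodule_hull) auto
  then have sub: "free_alg.subspace ?U"
    by (simp add: Uq_submodule_def)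
  have gens: "gen_map q g u \<in> ?U" if "u \<in> ?U" for g u
    using assms(3) U that by (rule gen_map_in_submodule)
  show "UU q \<inter> V_bold \<subseteq> ?U"
  proof (rule UU_Int_V_bold_subset[OF sub])
    fix a u assume u: "u \<in> ?U"
    show "strip_last a u \<in> ?U"
      using gens[OF u, of "E_gen N0"] gens[OF u, of "E_gen N1"] by (cases a) simp_all
    \<comment> \<open>Since q^2 is not 1, the scalars in \<open>gen_map_F\<close> are invertible and
      \<open>lower\<close> is recovered from the action of the F generators.\<close>
    have "q * q \<noteq> 1"
      using not_root_of_unity[of 2] by (simp add: power2_eq_square)
    then have "q - inverse q \<noteq> 0"
      by (simp add: field_simps)
    then have "q * (q - inverse q) * (inverse (q - inverse q) * inverse q) = 1"
      "(q - inverse q) * inverse (q - inverse q) = 1"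
      by (simp_all add: mult.assoc flip: mult.assoc[of "q - inverse q"])
    then have "scale (q * (q - inverse q)) (gen_map q (F_gen N0) u) = lower Lx u"
      "scale (q - inverse q) (gen_map q (F_gen N1) u) = lower Ly u"
      unfolding gen_map_F by simp_all
    then show "lower a u \<in> ?U"
      using free_alg.subspace_scale[OF sub gens[OF u]] by (cases a) metis+
  next
    show "word [] \<in> ?U"
      using hull_subset[of "{word []}" "Uq_submodule q act (UU q)"] by simp
  qed
qed

end
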